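(* Let $\mathcal G=\mathcal T$ or $\mathcal G=\mathcal T_o$. There exists a constant $C>0$ such that, for every $u\in H^1(\mathcal G)$, $$\int_{\mathcal G}|u'|^2dx-\lambda_1\int_{\mathcal G}|u|^2dx\ \ge\ C\,\|u\|_{L^\infty(\mathcal G)}^2,$$ with $C$ independent of $u$.
   Context: $\mathcal T$ (unrooted binary tree) is the infinite metric tree with all edges of length $1$ in which every vertex has degree $3$. $\mathcal T_o$ (rooted binary tree) is the infinite metric tree with all edges of length $1$ in which every vertex has degree $3$, except one vertex $o$ (the root), which has degree $1$. For $\mathcal G\in\{\mathcal T,\mathcal T_o\}$, $H^1(\mathcal G)$ is the space of continuous real-valued functions on $\mathcal G$ whose restriction to each edge is $H^1$ and such that $\int_{\mathcal G}(|u'|^2+|u|^2)\,dx<\infty$; all integrals are with respect to the length measure. The constant $\lambda_1$ is $\lambda_1:=\inf_{0\not\equiv u\in H^1(\mathcal T)}\frac{\int_{\mathcal T}|u'|^2dx}{\int_{\mathcal T}|u|^2dx}=\inf_{0\not\equiv u\in H^1(\mathcal T_o)}\frac{\int_{\mathcal T_o}|u'|^2dx}{\int_{\mathcal T_o}|u|^2dx}>0$ (it is known that the two infima coincide and are positive). *)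

theory Defs
  imports "HOL-Analysis.Analysis" "HOL-Probability.Essential_Supremum"
begin

section \<open>Metric trees\<close>

text \<open>
  A simple graph without isolated vertices is given by its set \<open>E\<close> of edges; its vertex set is
  \<open>Field E\<close>.  Every edge occurs in \<open>E\<close> exactly once, as a pair in one of its two orientations
  (this is \<open>asym E\<close>, which also excludes loops).  The orientation is arbitrary and serves only to
  parametrize the edge by arc length; all graph-theoretic notions refer to the symmetric closure.
\<close>

definition adj :: "('v \<times> 'v) set \<Rightarrow> ('v \<times> 'v) set" where
  "adj E = E \<union> E\<inverse>"

definition degree :: "('v \<times> 'v) set \<Rightarrow> 'v \<Rightarrow> nat" where
  "degree E v = card {w. (v, w) \<in> adj E}"

definition is_cycle :: "('v \<times> 'v) set \<Rightarrow> 'v list \<Rightarrow> bool" where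
  "is_cycle E p \<longleftrightarrow> length p \<ge> 3 \<and> distinct p \<and>
     (\<forall>i<length p. (p ! i, p ! (Suc i mod length p)) \<in> adj E)"

definition is_tree :: "('v \<times> 'v) set \<Rightarrow> bool" where
  "is_tree E \<longleftrightarrow> E \<noteq> {} \<and> asym E \<and>
     (\<forall>v\<in>Field E. \<forall>w\<in>Field E. (v, w) \<in> (adj E)\<^sup>*) \<and> (\<nexists>p. is_cycle E p)"

definition unrooted_binary_tree :: "('v \<times> 'v) set \<Rightarrow> bool" where
  "unrooted_binary_tree E \<longleftrightarrow> is_tree E \<and> infinite (Field E) \<and> (\<forall>v\<in>Field E. degree E v = 3)"

definition rooted_binary_tree :: "('v \<times> 'v) set \<Rightarrow> 'v \<Rightarrow> bool" where
  "rooted_binary_tree E r \<longleftrightarrow> is_tree E \<and> infinite (Field E) \<and>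
     r \<in> Field E \<and> degree E r = 1 \<and> (\<forall>v\<in>Field E - {r}. degree E v = 3)"

text \<open>
  The metric graph is the geometric realization of \<open>E\<close> in barycentric coordinates: the point at
  distance \<open>t\<close> from \<open>v\<close> on the edge \<open>(v, w)\<close> of length 1 has coordinate \<open>1 - t\<close> at \<open>v\<close>, \<open>t\<close> at \<open>w\<close>
  and \<open>0\<close> elsewhere.  A vertex \<open>v\<close> is thus the same point on every edge incident to it.
  On \<open>points E\<close> the product topology of \<open>'v \<Rightarrow> real\<close> is the topology of the path metric: for
  \<open>0 < \<epsilon> < 1\<close> the points with coordinate \<open>> 1 - \<epsilon>\<close> at \<open>v\<close> form the open ball of radius \<open>\<epsilon>\<close> about \<open>v\<close>,
  and the points whose coordinates at \<open>v\<close> and \<open>w\<close> are both positive form the open edge \<open>(v, w)\<close>.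
\<close>

definition edge_point :: "'v \<times> 'v \<Rightarrow> real \<Rightarrow> ('v \<Rightarrow> real)" where
  "edge_point e t = (\<lambda>x. if x = fst e then 1 - t else if x = snd e then t else 0)"

definition points :: "('v \<times> 'v) set \<Rightarrow> ('v \<Rightarrow> real) set" where
  "points E = (\<Union>e\<in>E. edge_point e ` {0..1})"


section \<open>Sobolev functions on the unit interval\<close>

definition L2_interval :: "(real \<Rightarrow> real) \<Rightarrow> bool" where
  "L2_interval f \<longleftrightarrow> f \<in> borel_measurable (lebesgue_on {0..1}) \<and>
     integrable (lebesgue_on {0..1}) (\<lambda>t. (f t)\<^sup>2)"

text \<open>The test functions are those in \<open>C\<^sup>1\<^sub>c(0,1)\<close>; \<open>\<phi>'\<close> is the derivative of \<open>\<phi>\<close>.\<close>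

definition test_function :: "(real \<Rightarrow> real) \<Rightarrow> (real \<Rightarrow> real) \<Rightarrow> bool" where
  "test_function \<phi> \<phi>' \<longleftrightarrow> (\<forall>t. (\<phi> has_real_derivative \<phi>' t) (at t)) \<and>
     continuous_on UNIV \<phi>' \<and> closure {t. \<phi> t \<noteq> 0} \<subseteq> {0<..<1}"

definition has_weak_deriv :: "(real \<Rightarrow> real) \<Rightarrow> (real \<Rightarrow> real) \<Rightarrow> bool" where
  "has_weak_deriv f g \<longleftrightarrow> (\<forall>\<phi> \<phi>'. test_function \<phi> \<phi>' \<longrightarrow>
     (LINT t|lebesgue_on {0..1}. f t * \<phi>' t) = - (LINT t|lebesgue_on {0..1}. g t * \<phi> t))"

definition H1_interval :: "(real \<Rightarrow> real) \<Rightarrow> bool" where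
  "H1_interval f \<longleftrightarrow> L2_interval f \<and> (\<exists>g. L2_interval g \<and> has_weak_deriv f g)"

text \<open>A representative of the weak derivative, which is unique up to null sets.\<close>

definition weak_deriv :: "(real \<Rightarrow> real) \<Rightarrow> (real \<Rightarrow> real)" where
  "weak_deriv f = (SOME g. L2_interval g \<and> has_weak_deriv f g)"


section \<open>Sobolev functions on a metric tree\<close>

text \<open>
  The length measure is Lebesgue measure on each edge, so integrals over the graph are sums over the
  edges.  Reversing an edge replaces \<open>u'\<close> by its reflected negative, hence the integrals below do not
  depend on the orientation.  Values of \<open>u\<close> outside \<open>points E\<close> are irrelevant.
\<close>

definition on_edge :: "(('v \<Rightarrow> real) \<Rightarrow> real) \<Rightarrow> 'v \<times> 'v \<Rightarrow> real \<Rightarrow> real" where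
  "on_edge u e = (\<lambda>t. u (edge_point e t))"

definition H1 :: "('v \<times> 'v) set \<Rightarrow> (('v \<Rightarrow> real) \<Rightarrow> real) set" where
  "H1 E = {u. continuous_on (points E) u \<and> (\<forall>e\<in>E. H1_interval (on_edge u e)) \<and>
     (\<lambda>e. LINT t|lebesgue_on {0..1}. (weak_deriv (on_edge u e) t)\<^sup>2 + (on_edge u e t)\<^sup>2) summable_on E}"

definition energy :: "('v \<times> 'v) set \<Rightarrow> (('v \<Rightarrow> real) \<Rightarrow> real) \<Rightarrow> real" where
  "energy E u = (\<Sum>\<^sub>\<infinity>e\<in>E. LINT t|lebesgue_on {0..1}. (weak_deriv (on_edge u e) t)\<^sup>2)"

definition mass :: "('v \<times> 'v) set \<Rightarrow> (('v \<Rightarrow> real) \<Rightarrow> real) \<Rightarrow> real" where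
  "mass E u = (\<Sum>\<^sub>\<infinity>e\<in>E. LINT t|lebesgue_on {0..1}. (on_edge u e t)\<^sup>2)"

definition Linf_norm :: "('v \<times> 'v) set \<Rightarrow> (('v \<Rightarrow> real) \<Rightarrow> real) \<Rightarrow> ereal" where
  "Linf_norm E u = (SUP e\<in>E. esssup (lebesgue_on {0..1}) (\<lambda>t. ereal \<bar>on_edge u e t\<bar>))"

definition lambda1 :: "('v \<times> 'v) set \<Rightarrow> real" where
  "lambda1 E = (INF u\<in>{u\<in>H1 E. \<exists>x\<in>points E. u x \<noteq> 0}. energy E u / mass E u)"

end

theory Submission
  imports Defs
begin

text \<open>
  Let \<open>\<theta> = arcsin (1/3)\<close>, so that \<open>cos \<theta> = 2\<surd>2/3\<close>; the number \<open>\<theta>\<^sup>2\<close> is the bottom of the spectrum.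
  The proof has two halves: \<open>energy - \<theta>\<^sup>2 mass\<close> controls the supremum norm on both trees, and
  \<open>\<lambda>\<^sub>1 \<le> \<theta>\<^sup>2\<close> on the unrooted one.

  On a single edge with end values \<open>a\<close> and \<open>b\<close>, compare \<open>u\<close> with the solution \<open>s\<close> of \<open>s'' = - \<theta>\<^sup>2 s\<close> that
  has the same end values.  The cross terms vanish, and
  \<open>\<integral>u'\<^sup>2 - \<theta>\<^sup>2\<integral>u\<^sup>2\<close> equals \<open>\<theta>/sin \<theta> \<cdot> (cos \<theta> (a\<^sup>2 + b\<^sup>2) - 2ab)\<close> plus the same expression in \<open>u - s\<close>, which
  dominates half the square of \<open>u - s\<close> at every point because \<open>u - s\<close> vanishes at both ends and \<open>\<theta>\<close> is small
  (\<open>interval_energy_identity\<close>, \<open>interval_energy_lower_bound\<close>).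

  This leaves a quadratic form in the vertex values.  Root the tree at a vertex \<open>p\<close>.  If \<open>a\<close> belongs to
  the parent and \<open>b\<close> to the child, then \<open>2ab \<le> a\<^sup>2/\<surd>2 + \<surd>2 b\<^sup>2\<close>.  A vertex of degree 3 other than \<open>p\<close> has two
  children and one parent, so it is charged \<open>2/\<surd>2 + \<surd>2 = 2\<surd>2\<close>, which is exactly the amount \<open>3 cos \<theta>\<close> that it
  owns.  The root \<open>p\<close> has three children and no parent; it is charged only \<open>3/\<surd>2\<close> and keeps a positive
  multiple of \<open>u(p)\<^sup>2\<close>.  As \<open>p\<close> is arbitrary, every vertex value is bounded with the same constant
  (\<open>critical_energy_lower_bound\<close>).  In the rooted tree the vertex \<open>r\<close> of degree 1 goes into
  debt when \<open>p \<noteq> r\<close>; the choice \<open>p = r\<close> leaves a surplus there, which bounds \<open>u(r)\<^sup>2\<close> and so pays the debt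
  (\<open>rooted_Linf_bound\<close>).

  For the upper bound on \<open>\<lambda>\<^sub>1\<close>, the inequality for \<open>2ab\<close> is an equality when \<open>a = \<surd>2 b\<close>.  The trial function
  with values \<open>2\<^sup>-\<^sup>n\<^sup>/\<^sup>2\<close> at depth \<open>n \<le> N\<close>, zero beyond, and sine profiles in between therefore has
  \<open>energy - \<theta>\<^sup>2 mass\<close> equal to the contribution of the edges between depths \<open>N\<close> and \<open>N + 1\<close>.  That is a
  constant independent of \<open>N\<close>, while the mass grows linearly (\<open>trial_defect\<close>, \<open>trial_mass_ge\<close>).
\<close>

section \<open>Square-integrable functions on the unit interval\<close>

abbreviation unit_interval :: "real measure" where
  "unit_interval \<equiv> lebesgue_on {0..1}"

lemma L2_interval_borel: "L2_interval f \<Longrightarrow> f \<in> borel_measurable unit_interval"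
  by (simp add: L2_interval_def)

lemma L2_interval_integrable_mult:
  assumes "L2_interval f" "L2_interval g"
  shows "integrable unit_interval (\<lambda>t. f t * g t)"
proof (rule Bochner_Integration.integrable_bound)
  show "integrable unit_interval (\<lambda>t. (f t)\<^sup>2 + (g t)\<^sup>2)"
    using assms by (auto simp: L2_interval_def)
  show "(\<lambda>t. f t * g t) \<in> borel_measurable unit_interval"
    using assms by (auto simp: L2_interval_def)
  have "\<bar>x * y\<bar> \<le> x\<^sup>2 + y\<^sup>2" for x y :: real
  proof -
    have "2 * (\<bar>x\<bar> * \<bar>y\<bar>) \<le> x\<^sup>2 + y\<^sup>2" "0 \<le> \<bar>x\<bar> * \<bar>y\<bar>"
      using sum_squares_bound[of "\<bar>x\<bar>" "\<bar>y\<bar>"] by (auto simp: mult.assoc)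
    then show ?thesis unfolding abs_mult by linarith
  qed
  then show "AE t in unit_interval. norm (f t * g t) \<le> norm ((f t)\<^sup>2 + (g t)\<^sup>2)"
    by (intro always_eventually) (metis abs_ge_self order_trans real_norm_def)
qed

lemma L2_interval_integrable_square:
  "L2_interval f \<Longrightarrow> integrable unit_interval (\<lambda>t. (f t)\<^sup>2)"
  by (simp add: L2_interval_def)

lemma L2_interval_add:
  assumes "L2_interval f" "L2_interval g"
  shows "L2_interval (\<lambda>t. f t + g t)"
proof -
  have "integrable unit_interval (\<lambda>t. (f t)\<^sup>2 + (g t)\<^sup>2 + 2 * (f t * g t))"
    using assms L2_interval_integrable_mult[OF assms]
    by (intro Bochner_Integration.integrable_add) (auto simp: L2_interval_def)
  then show ?thesis
    using assms by (auto simp: L2_interval_def power2_sum mult.assoc)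
qed

lemma L2_interval_cmult: "L2_interval f \<Longrightarrow> L2_interval (\<lambda>t. c * f t)"
  by (auto simp: L2_interval_def power_mult_distrib)

lemma L2_interval_diff:
  assumes "L2_interval f" "L2_interval g"
  shows "L2_interval (\<lambda>t. f t - g t)"
  using L2_interval_add[OF assms(1) L2_interval_cmult[OF assms(2), of "-1"]] by simp

lemma L2_interval_continuous:
  assumes "continuous_on {0..1} f"
  shows "L2_interval f"
  using assms unfolding L2_interval_def
  by (auto intro!: continuous_imp_integrable_real continuous_intros
      continuous_imp_measurable_on_sets_lebesgue)

lemma borel_measurable_indicator_unit_interval:
  "A \<in> sets borel \<Longrightarrow> indicat_real A \<in> borel_measurable unit_interval"
  by (intro borel_measurable_indicator') (auto simp: sets_restrict_space)

lemma L2_interval_indicator: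
  assumes "L2_interval f" "A \<in> sets borel"
  shows "L2_interval (\<lambda>t. indicator A t * f t)"
  unfolding L2_interval_def
proof
  have A: "indicat_real A \<in> borel_measurable unit_interval"
    using assms(2) by (rule borel_measurable_indicator_unit_interval)
  show meas: "(\<lambda>t. indicator A t * f t) \<in> borel_measurable unit_interval"
    using A L2_interval_borel[OF assms(1)] by (rule borel_measurable_times)
  show "integrable unit_interval (\<lambda>t. (indicator A t * f t)\<^sup>2)"
    by (rule Bochner_Integration.integrable_bound[OF L2_interval_integrable_square[OF assms(1)]])
       (use meas in \<open>auto simp: indicator_def\<close>)
qed

lemma L2_interval_integrable:
  assumes "L2_interval f"
  shows "integrable unit_interval f"
  using L2_interval_integrable_mult[OF assms L2_interval_continuous[of "\<lambda>_. 1"]] by simp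

lemma unit_integral_FTC:
  fixes F F' :: "real \<Rightarrow> real"
  assumes "\<And>t. t \<in> {0..1} \<Longrightarrow> (F has_real_derivative F' t) (at t)" "continuous_on {0..1} F'"
  shows "(LINT t|unit_interval. F' t) = F 1 - F 0"
proof -
  have "(F' has_integral F 1 - F 0) {0..1}"
    by (rule fundamental_theorem_of_calculus)
       (use assms(1) in \<open>auto simp: has_real_derivative_iff_has_vector_derivative[symmetric]
          intro: has_field_derivative_at_within\<close>)
  then show ?thesis
    using assms(2) by (subst lebesgue_integral_eq_integral)
      (auto intro: continuous_imp_integrable_real simp: integral_unique)
qed

section \<open>Integration by parts for weak derivatives\<close>

text \<open>
  A continuously differentiable step built from the positive part squared, which is the simplest
  function that is \<open>C\<^sup>1\<close> across the end of its support.
\<close>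

definition pos_sq :: "real \<Rightarrow> real" where
  "pos_sq z = (max 0 z)\<^sup>2"

lemma has_real_derivative_pos_sq: "(pos_sq has_real_derivative 2 * max 0 z) (at z)"
proof -
  consider "z < 0" | "z = 0" | "z > 0" by linarith
  then show ?thesis
  proof cases
    case 1
    have "((\<lambda>_. 0) has_real_derivative 2 * max 0 z) (at z)" using 1 by auto
    then show ?thesis
      by (rule has_field_derivative_transform_within_open[where S="{..<0}"])
        (use 1 in \<open>auto simp: pos_sq_def\<close>)
  next
    case 3
    have "((\<lambda>z. z\<^sup>2) has_real_derivative 2 * max 0 z) (at z)" 
      using 3 by (auto intro!: derivative_eq_intros)
    then show ?thesis
      by (rule has_field_derivative_transform_within_open[where S="{0<..}"])
        (use 3 in \<open>auto simp: pos_sq_def\<close>)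
  next
    case 2
    have "((\<lambda>y. pos_sq y / y) \<longlongrightarrow> 0) (at 0)"
    proof (rule Lim_null_comparison)
      show "\<forall>\<^sub>F y in at 0. norm (pos_sq y / y) \<le> \<bar>y\<bar>"
        by (auto simp: pos_sq_def max_def power2_eq_square intro!: always_eventually)
      show "((\<lambda>y. \<bar>y\<bar>) \<longlongrightarrow> (0::real)) (at 0)"
        by (auto intro!: tendsto_eq_intros)
    qed
    then show ?thesis
      using 2 by (simp add: has_field_derivative_iff pos_sq_def)
  qed
qed

definition smooth_step :: "real \<Rightarrow> real" where
  "smooth_step z = 1 - pos_sq (1 - pos_sq z)"

definition smooth_bump :: "real \<Rightarrow> real" where
  "smooth_bump z = 2 * max 0 (1 - pos_sq z) * (2 * max 0 z)"

lemma has_real_derivative_smooth_step: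
  "(smooth_step has_real_derivative smooth_bump z) (at z)"
proof -
  have "((\<lambda>z. 1 - pos_sq (1 - pos_sq z)) has_real_derivative smooth_bump z) (at z)"
    by (rule derivative_eq_intros DERIV_chain2[OF has_real_derivative_pos_sq]
        has_real_derivative_pos_sq refl | simp add: smooth_bump_def)+
  then show ?thesis by (simp add: smooth_step_def[abs_def])
qed

lemma has_real_derivative_smooth_step_affine:
  "((\<lambda>t. smooth_step (a * (t - x) - c)) has_real_derivative a * smooth_bump (a * (t - x) - c)) (at t)"
proof -
  have "((\<lambda>t. a * (t - x) - c) has_real_derivative a) (at t)"
    by (auto intro!: derivative_eq_intros)
  from DERIV_chain2[OF has_real_derivative_smooth_step this] show ?thesis
    by (simp add: mult.commute)
qed

lemma continuous_on_pos_sq: "continuous_on A pos_sq"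
  unfolding pos_sq_def by (intro continuous_intros)

lemma continuous_smooth_bump: "continuous_on A smooth_bump"
  unfolding smooth_bump_def by (intro continuous_intros continuous_on_pos_sq)

lemma pos_sq_ge1: "z \<ge> 1 \<Longrightarrow> pos_sq z \<ge> 1"
  unfolding pos_sq_def by (rule one_le_power) simp

lemma smooth_step_0: "z \<le> 0 \<Longrightarrow> smooth_step z = 0"
  by (simp add: pos_sq_def max_def smooth_step_def)

lemma smooth_step_1: "z \<ge> 1 \<Longrightarrow> smooth_step z = 1"
  using pos_sq_ge1[of z] by (simp add: smooth_step_def pos_sq_def[of "1 - _"])

lemma smooth_bump_0: "z \<le> 0 \<or> z \<ge> 1 \<Longrightarrow> smooth_bump z = 0"
  using pos_sq_ge1[of z] by (auto simp: smooth_bump_def)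

lemma smooth_bump_nonneg: "smooth_bump z \<ge> 0"
  by (simp add: smooth_bump_def)

lemma smooth_step_bounds: "0 \<le> smooth_step z" "smooth_step z \<le> 1"
proof -
  have "0 \<le> pos_sq z" for z by (simp add: pos_sq_def)
  moreover from this[of z] have "pos_sq (1 - pos_sq z) \<le> 1"
    unfolding pos_sq_def[of "1 - _"] by (intro power_le_one) auto
  ultimately show "0 \<le> smooth_step z" "smooth_step z \<le> 1"
    by (auto simp: smooth_step_def)
qed

text \<open>
  Nonnegative kernels of mass one that concentrate at \<open>x\<close> reproduce the value of a continuous
  function there.  The point \<open>x\<close> may be an end point of the interval; the mass condition is what makes
  the kernels one-sided in that case.
\<close>

lemma unit_integral_approx_identity:
  fixes k :: "nat \<Rightarrow> real \<Rightarrow> real"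
  assumes G: "continuous_on {0..1} G" and x: "x \<in> {0..1}"
    and k: "\<And>n. continuous_on {0..1} (k n)" "\<And>n t. k n t \<ge> 0"
    and supp: "\<And>n t. k n t \<noteq> 0 \<Longrightarrow> \<bar>t - x\<bar> \<le> 2 / real n"
    and mass: "\<forall>\<^sub>F n in sequentially. (LINT t|unit_interval. k n t) = 1"
  shows "(\<lambda>n. LINT t|unit_interval. G t * k n t) \<longlonglongrightarrow> G x"
proof (rule LIMSEQ_I)
  fix \<epsilon> :: real assume "\<epsilon> > 0"
  then have "\<epsilon> / 2 > 0" by simp
  then obtain d where d: "d > 0" "\<And>t. t \<in> {0..1} \<Longrightarrow> dist t x < d \<Longrightarrow> dist (G t) (G x) < \<epsilon> / 2"
    using G x unfolding continuous_on_iff by metis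
  obtain m where m: "\<And>n. n \<ge> m \<Longrightarrow> (LINT t|unit_interval. k n t) = 1"
    using mass unfolding eventually_sequentially by auto
  obtain m' :: nat where m': "2 / d < real m'" using reals_Archimedean2 by blast
  have "norm ((LINT t|unit_interval. G t * k n t) - G x) < \<epsilon>" if n: "n \<ge> max m m'" for n
  proof -
    have nd: "2 / real n < d"
    proof -
      have "2 / d < real n" using m' n by linarith
      moreover from this \<open>d > 0\<close> have "real n > 0"
        by (meson divide_pos_pos less_trans zero_less_numeral)
      ultimately show ?thesis using \<open>d > 0\<close> by (simp add: field_simps)
    qed
    have L: "L2_interval (k n)" "L2_interval G" using k G by (auto intro: L2_interval_continuous)
    have int: "integrable unit_interval (\<lambda>t. G t * k n t)"
      by (intro L2_interval_integrable_mult L)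
    have ink: "integrable unit_interval (k n)" by (intro L2_interval_integrable L)
    have eq: "(LINT t|unit_interval. (G t - G x) * k n t) = (LINT t|unit_interval. G t * k n t) - G x"
      using int ink m[of n] n by (simp add: left_diff_distrib)
    have "norm (LINT t|unit_interval. (G t - G x) * k n t)
        \<le> (LINT t|unit_interval. norm ((G t - G x) * k n t))"
      by (rule integral_norm_bound)
    also have "\<dots> \<le> (LINT t|unit_interval. \<epsilon> / 2 * k n t)"
    proof (rule integral_mono)
      show "integrable unit_interval (\<lambda>t. norm ((G t - G x) * k n t))"
        using int ink by (intro integrable_norm) (auto simp: left_diff_distrib)
      show "integrable unit_interval (\<lambda>t. \<epsilon> / 2 * k n t)" using ink by simp
      fix t assume "t \<in> space unit_interval"
      then have t: "t \<in> {0..1}" by simp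
      show "norm ((G t - G x) * k n t) \<le> \<epsilon> / 2 * k n t"
      proof (cases "k n t = 0")
        case False
        then have "dist t x < d" using supp[of n t] nd by (simp add: dist_real_def)
        then have "\<bar>G t - G x\<bar> \<le> \<epsilon> / 2" using d(2)[OF t] by (simp add: dist_real_def)
        then show ?thesis using mult_right_mono[OF _ k(2)[of n t], of _ "\<epsilon> / 2"] k(2)[of n t] by (simp add: abs_mult)
      qed simp
    qed
    also have "\<dots> = \<epsilon> / 2" using m[of n] n by simp
    finally show ?thesis using eq \<open>\<epsilon> > 0\<close> by simp
  qed
  then show "\<exists>no. \<forall>n\<ge>no. norm ((LINT t|unit_interval. G t * k n t) - G x) < \<epsilon>" by blast
qed

text \<open>
  The shift \<open>c\<close> decides on which side of \<open>x\<close> the bump lives: for \<open>c = 1\<close> its support is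
  \<open>[x + 1/n, x + 2/n]\<close>, for \<open>c = - 2\<close> it is \<open>[x - 2/n, x - 1/n]\<close>.
\<close>

lemma rescaled_bump_tendsto:
  assumes G: "continuous_on {0..1} G" and x: "x \<in> {0..1}"
    and c: "x < 1 \<and> c = 1 \<or> x > 0 \<and> c = - 2"
  shows "(\<lambda>n. LINT t|unit_interval. G t * (real n * smooth_bump (real n * (t - x) - c)))
           \<longlonglongrightarrow> G x"
proof (rule unit_integral_approx_identity[OF G x])
  fix n :: nat and t :: real
  show "continuous_on {0..1} (\<lambda>t. real n * smooth_bump (real n * (t - x) - c))"
    by (intro continuous_intros continuous_on_compose2[OF continuous_smooth_bump[of UNIV]]) auto
  show "0 \<le> real n * smooth_bump (real n * (t - x) - c)" by (simp add: smooth_bump_nonneg)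
  assume nz: "real n * smooth_bump (real n * (t - x) - c) \<noteq> 0"
  then have n: "real n > 0" by auto
  have "smooth_bump (real n * (t - x) - c) \<noteq> 0" using nz by auto
  then have "0 < real n * (t - x) - c" "real n * (t - x) - c < 1"
    using smooth_bump_0[of "real n * (t - x) - c"] by linarith+
  then have "\<bar>real n * (t - x)\<bar> \<le> 2" using c by linarith
  then have "\<bar>t - x\<bar> * real n \<le> 2" by (simp add: abs_mult mult.commute)
  then show "\<bar>t - x\<bar> \<le> 2 / real n" using n by (subst pos_le_divide_eq)
next
  obtain m :: nat where m: "2 / (if c = 1 then 1 - x else x) < real m" using reals_Archimedean2 by blast
  have "(LINT t|unit_interval. real n * smooth_bump (real n * (t - x) - c)) = 1" if "n \<ge> m" for n
  proof -
    have eq: "(LINT t|unit_interval. real n * smooth_bump (real n * (t - x) - c))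
        = smooth_step (real n * (1 - x) - c) - smooth_step (real n * (0 - x) - c)"
      by (rule unit_integral_FTC[where F="\<lambda>t. smooth_step (real n * (t - x) - c)"])
         (auto intro!: has_real_derivative_smooth_step_affine continuous_intros continuous_on_compose2[OF continuous_smooth_bump[of UNIV]])
    have "2 / (if c = 1 then 1 - x else x) < real n" using m that by linarith
    then have "2 < real n * (if c = 1 then 1 - x else x)"
      using c by (auto simp: field_simps split: if_splits)
    moreover have "0 \<le> real n * (1 - x)" "0 \<le> real n * x" using x by auto
    ultimately have "smooth_step (real n * (1 - x) - c) = 1" "smooth_step (real n * (0 - x) - c) = 0"
      using c by (intro smooth_step_1 smooth_step_0; auto)+
    then show ?thesis unfolding eq by simp
  qed
  then show "\<forall>\<^sub>F n in sequentially. (LINT t|unit_interval. real n * smooth_bump (real n * (t - x) - c)) = 1"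
    unfolding eventually_sequentially by blast
qed

text \<open>
  The test functions in the definition of a weak derivative vanish near both end points.  Here \<open>\<psi>\<close> is
  multiplied by a smooth window that rises from 0 to 1 just to the right of \<open>x\<close> and falls back to 0 just
  to the left of \<open>y\<close>.  As the two ramps shrink, the window tends to the indicator of the open interval,
  and its derivative tends to a point mass at \<open>x\<close> minus one at \<open>y\<close>, which yields the boundary terms.
  With \<open>\<psi> = 1\<close> this is the fundamental theorem of calculus for weak derivatives.
\<close>

lemma weak_deriv_by_parts:
  fixes f g \<psi> \<psi>' :: "real \<Rightarrow> real"
  assumes f: "continuous_on {0..1} f" and g: "L2_interval g" and fg: "has_weak_deriv f g"
    and xy: "0 \<le> x" "x < y" "y \<le> 1"
    and \<psi>: "\<And>t. (\<psi> has_real_derivative \<psi>' t) (at t)" and \<psi>': "continuous_on UNIV \<psi>'"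
  shows "(LINT t|unit_interval. indicator {x<..<y} t * (f t * \<psi>' t + g t * \<psi> t))
           = f y * \<psi> y - f x * \<psi> x"
proof -
  define window where "window n t = smooth_step (real n * (t - x) - 1) - smooth_step (real n * (t - y) - (- 2))"
    for n t
  define bump_x where "bump_x n t = real n * smooth_bump (real n * (t - x) - 1)" for n t
  define bump_y where "bump_y n t = real n * smooth_bump (real n * (t - y) - (- 2))" for n t
  have window: "(window n has_real_derivative bump_x n t - bump_y n t) (at t)" for n t
    unfolding window_def[abs_def] bump_x_def bump_y_def
    by (intro derivative_intros has_real_derivative_smooth_step_affine)
  have cont_\<psi>: "continuous_on A \<psi>" for A
    using DERIV_isCont[OF \<psi>] by (auto intro: continuous_at_imp_continuous_on)
  have cont_\<psi>': "continuous_on A \<psi>'" for A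
    using \<psi>' by (rule continuous_on_subset) simp
  have cont_window: "continuous_on A (window n)" for A n
    using DERIV_isCont[OF window] by (auto intro: continuous_at_imp_continuous_on)
  have cont_b: "continuous_on A (bump_x n)" "continuous_on A (bump_y n)" for A n
    unfolding bump_x_def bump_y_def
    by (intro continuous_intros continuous_on_compose2[OF continuous_smooth_bump[of UNIV]] subset_UNIV)+
  have L: "L2_interval f" "L2_interval \<psi>" "L2_interval \<psi>'" "L2_interval (window n)" "L2_interval (bump_x n)"
    "L2_interval (bump_y n)" for n
    by (intro L2_interval_continuous f cont_\<psi> cont_\<psi>' cont_window cont_b)+
  define p where "p t = f t * \<psi>' t + g t * \<psi> t" for t
  have int_p: "integrable unit_interval p"
    unfolding p_def[abs_def]
    by (intro Bochner_Integration.integrable_add L2_interval_integrable_mult L g)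
  \<comment> \<open>For \<open>n \<ge> n0\<close> each ramp is over before the far end of the other, so the window vanishes outside \<open>[x + 1/n, y - 1/n]\<close>.\<close>
  obtain n0 :: nat where n0: "3 / (y - x) < real n0" using reals_Archimedean2 by blast
  have sum_zero: "(LINT t|unit_interval. window n t * p t) + (LINT t|unit_interval. (f t * \<psi> t) * bump_x n t)
      - (LINT t|unit_interval. (f t * \<psi> t) * bump_y n t) = 0" if n: "n \<ge> n0" for n
  proof -
    have "3 / (y - x) < real n" using n n0 by linarith
    then have big: "3 < real n * (y - x)" and pos: "real n > 0"
      using xy by (simp add: field_simps) (metis \<open>3 / (y - x) < real n\<close> diff_gt_0_iff_gt divide_pos_pos less_trans xy(2) zero_less_numeral)
    have van: "window n t = 0" if "t \<notin> {x + 1 / n..y - 1 / n}" for t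
    proof (cases "t < x + 1 / n")
      case True
      then have 1: "real n * (t - x) \<le> 1" using pos by (simp add: field_simps)
      then have "real n * (t - y) \<le> - 2" using big by (simp add: algebra_simps)
      with 1 show ?thesis by (simp add: window_def smooth_step_0)
    next
      case False
      then have "t > y - 1 / n" using that by auto
      then have 1: "real n * (t - y) \<ge> - 1" using pos by (simp add: field_simps)
      then have "real n * (t - x) \<ge> 2" using big by (simp add: algebra_simps)
      with 1 show ?thesis by (simp add: window_def smooth_step_1)
    qed
    have "test_function (\<lambda>t. \<psi> t * window n t) (\<lambda>t. \<psi>' t * window n t + \<psi> t * (bump_x n t - bump_y n t))"
      unfolding test_function_def
    proof (intro conjI allI)
      show "((\<lambda>t. \<psi> t * window n t) has_real_derivative \<psi>' t * window n t + \<psi> t * (bump_x n t - bump_y n t)) (at t)" for t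
        by (rule DERIV_mult'[OF \<psi> window, THEN DERIV_cong]) simp
      show "continuous_on UNIV (\<lambda>t. \<psi>' t * window n t + \<psi> t * (bump_x n t - bump_y n t))"
        by (intro continuous_intros cont_\<psi> cont_\<psi>' cont_window cont_b)
      have "closure {t. \<psi> t * window n t \<noteq> 0} \<subseteq> {x + 1 / n..y - 1 / n}"
      proof (rule closure_minimal)
        show "{t. \<psi> t * window n t \<noteq> 0} \<subseteq> {x + 1 / n..y - 1 / n}" using van by fastforce
      qed simp
      also have "\<dots> \<subseteq> {0<..<1}"
      proof
        fix t assume "t \<in> {x + 1 / n..y - 1 / n}"
        moreover have "1 / real n > 0" using pos by simp
        ultimately have "0 < t" "t < 1" using xy unfolding atLeastAtMost_iff by linarith+
        then show "t \<in> {0<..<1}" by simp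
      qed
      finally show "closure {t. \<psi> t * window n t \<noteq> 0} \<subseteq> {0<..<1}" .
    qed
    then have eq: "(LINT t|unit_interval. f t * (\<psi>' t * window n t + \<psi> t * (bump_x n t - bump_y n t)))
        = - (LINT t|unit_interval. g t * (\<psi> t * window n t))"
      using fg unfolding has_weak_deriv_def by blast
    have L3: "L2_interval (\<lambda>t. \<psi>' t * window n t)" "L2_interval (\<lambda>t. \<psi> t * window n t)"
      "L2_interval (\<lambda>t. \<psi> t * bump_x n t)" "L2_interval (\<lambda>t. \<psi> t * bump_y n t)"
      by (intro L2_interval_continuous continuous_intros cont_\<psi> cont_\<psi>' cont_window cont_b)+
    note I = L2_interval_integrable_mult[OF L(1) L3(1)] L2_interval_integrable_mult[OF g L3(2)]
      L2_interval_integrable_mult[OF L(1) L3(3)] L2_interval_integrable_mult[OF L(1) L3(4)]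
    have "(LINT t|unit_interval. f t * (\<psi>' t * window n t + \<psi> t * (bump_x n t - bump_y n t)))
      = (LINT t|unit_interval. f t * (\<psi>' t * window n t)) + (LINT t|unit_interval. f t * (\<psi> t * bump_x n t))
        - (LINT t|unit_interval. f t * (\<psi> t * bump_y n t))"
      using I by (simp add: distrib_left right_diff_distrib)
    moreover have "(LINT t|unit_interval. window n t * p t)
      = (LINT t|unit_interval. f t * (\<psi>' t * window n t)) + (LINT t|unit_interval. g t * (\<psi> t * window n t))"
      using I by (simp add: p_def distrib_left mult_ac)
    ultimately show ?thesis using eq by (simp add: mult.assoc)
  qed
  have lim_window: "(\<lambda>n. LINT t|unit_interval. window n t * p t) \<longlonglongrightarrow> (LINT t|unit_interval. indicator {x<..<y} t * p t)"
  proof (rule integral_dominated_convergence[where w="\<lambda>t. \<bar>p t\<bar>"])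
    show "(\<lambda>t. indicator {x<..<y} t * p t) \<in> borel_measurable unit_interval"
      using int_p by (intro borel_measurable_times borel_measurable_indicator_unit_interval) auto
    show "(\<lambda>t. window n t * p t) \<in> borel_measurable unit_interval" for n
      using int_p L2_interval_borel[OF L(4)[of n]] by (intro borel_measurable_times) auto
    show "integrable unit_interval (\<lambda>t. \<bar>p t\<bar>)" using int_p by simp
    have "\<bar>window n t\<bar> \<le> 1" for n t
      using smooth_step_bounds[of "real n * (t - x) - 1"]
        smooth_step_bounds[of "real n * (t - y) - (- 2)"] by (simp add: window_def)
    then show "AE t in unit_interval. norm (window n t * p t) \<le> \<bar>p t\<bar>" for n
      by (auto simp: abs_mult intro!: mult_left_le_one_le always_eventually)
    have "(\<lambda>n. window n t) \<longlonglongrightarrow> indicator {x<..<y} t" for t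
    proof (rule tendsto_eventually)
      obtain m1 :: nat where m1: "2 / (t - x) < real m1" using reals_Archimedean2 by blast
      obtain m2 :: nat where m2: "2 / (y - t) < real m2" using reals_Archimedean2 by blast
      have "window n t = indicator {x<..<y} t" if n: "n \<ge> max n0 (max m1 m2)" for n
      proof -
        have "3 / (y - x) < real n" using n n0 by linarith
        then have big: "3 < real n * (y - x)" using xy by (simp add: field_simps)
        consider "t \<le> x" | "t \<ge> y" | "x < t" "t < y" by linarith
        then show ?thesis
        proof cases
          case 1
          then have "real n * (t - x) \<le> 0" by (simp add: mult_nonneg_nonpos)
          moreover from this have "real n * (t - y) \<le> -3" using big by (simp add: algebra_simps)
          ultimately show ?thesis using 1 by (simp add: window_def smooth_step_0)
        next
          case 2
          then have "real n * (t - y) \<ge> 0" by simp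
          moreover from this have "real n * (t - x) \<ge> 3" using big by (simp add: algebra_simps)
          ultimately show ?thesis using 2 by (simp add: window_def smooth_step_1)
        next
          case 3
          have "2 / (t - x) < real n" "2 / (y - t) < real n" using m1 m2 n by linarith+
          then have "2 < real n * (t - x)" "2 < real n * (y - t)" using 3 by (simp_all add: field_simps)
          then show ?thesis using 3
            by (simp add: window_def smooth_step_1 smooth_step_0 right_diff_distrib)
        qed
      qed
      then show "\<forall>\<^sub>F n in sequentially. window n t = indicator {x<..<y} t"
        unfolding eventually_sequentially by blast
    qed
    then show "AE t in unit_interval. (\<lambda>n. window n t * p t) \<longlonglongrightarrow> indicator {x<..<y} t * p t"
      by (intro always_eventually allI tendsto_mult tendsto_const)
  qed
  have cf: "continuous_on {0..1} (\<lambda>t. f t * \<psi> t)" by (intro continuous_intros f cont_\<psi>)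
  have "(\<lambda>n. (LINT t|unit_interval. window n t * p t) + (LINT t|unit_interval. (f t * \<psi> t) * bump_x n t)
      - (LINT t|unit_interval. (f t * \<psi> t) * bump_y n t))
    \<longlonglongrightarrow> (LINT t|unit_interval. indicator {x<..<y} t * p t) + f x * \<psi> x - f y * \<psi> y"
    unfolding bump_x_def bump_y_def
    by (intro tendsto_intros lim_window rescaled_bump_tendsto[OF cf]) (use xy in auto)
  moreover have "(\<lambda>n. (LINT t|unit_interval. window n t * p t) + (LINT t|unit_interval. (f t * \<psi> t) * bump_x n t)
      - (LINT t|unit_interval. (f t * \<psi> t) * bump_y n t)) \<longlonglongrightarrow> 0"
    by (rule tendsto_eventually) (use sum_zero in \<open>auto simp: eventually_sequentially\<close>)
  ultimately have "(LINT t|unit_interval. indicator {x<..<y} t * p t) + f x * \<psi> x - f y * \<psi> y = 0"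
    by (rule LIMSEQ_unique)
  then show ?thesis by (simp add: p_def)
qed

lemma C1_has_weak_deriv:
  assumes F: "\<And>t. t \<in> {0..1} \<Longrightarrow> (F has_real_derivative F' t) (at t)" and F': "continuous_on {0..1} F'"
  shows "has_weak_deriv F F'"
  unfolding has_weak_deriv_def
proof (intro allI impI)
  fix \<phi> \<phi>' assume t: "test_function \<phi> \<phi>'"
  have \<phi>: "\<And>t. (\<phi> has_real_derivative \<phi>' t) (at t)" using t by (simp add: test_function_def)
  have c: "continuous_on {0..1} \<phi>'" "continuous_on {0..1} \<phi>" "continuous_on {0..1} F"
    using t DERIV_isCont[OF \<phi>] DERIV_isCont[OF F]
    by (auto simp: test_function_def intro: continuous_on_subset continuous_at_imp_continuous_on)
  have van: "\<phi> t = 0" if "t \<notin> {0<..<1}" for t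
    using t that closure_subset[of "{t. \<phi> t \<noteq> 0}"] by (auto simp: test_function_def)
  have "(LINT t|unit_interval. F t * \<phi>' t + F' t * \<phi> t) = F 1 * \<phi> 1 - F 0 * \<phi> 0"
    by (rule unit_integral_FTC[where F="\<lambda>t. F t * \<phi> t"])
      (auto intro!: DERIV_mult' F \<phi> continuous_intros c F')
  moreover have "integrable unit_interval (\<lambda>t. F t * \<phi>' t)" "integrable unit_interval (\<lambda>t. F' t * \<phi> t)"
    by (intro L2_interval_integrable_mult L2_interval_continuous c F')+
  ultimately show "(LINT t|unit_interval. F t * \<phi>' t) = - (LINT t|unit_interval. F' t * \<phi> t)"
    using van by simp
qed

lemma has_weak_deriv_diff:
  assumes "has_weak_deriv f1 g1" "has_weak_deriv f2 g2"
    and "L2_interval f1" "L2_interval g1" "L2_interval f2" "L2_interval g2"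
  shows "has_weak_deriv (\<lambda>t. f1 t - f2 t) (\<lambda>t. g1 t - g2 t)"
  unfolding has_weak_deriv_def
proof (intro allI impI)
  fix \<phi> \<phi>' assume t: "test_function \<phi> \<phi>'"
  then have \<phi>: "\<And>t. (\<phi> has_real_derivative \<phi>' t) (at t)" by (simp add: test_function_def)
  have "continuous_on {0..1} \<phi>'" "continuous_on {0..1} \<phi>"
    using t DERIV_isCont[OF \<phi>]
    by (auto simp: test_function_def intro: continuous_on_subset continuous_at_imp_continuous_on)
  then have "L2_interval \<phi>'" "L2_interval \<phi>" by (auto intro: L2_interval_continuous)
  then have "integrable unit_interval (\<lambda>t. f1 t * \<phi>' t)" "integrable unit_interval (\<lambda>t. f2 t * \<phi>' t)"
    "integrable unit_interval (\<lambda>t. g1 t * \<phi> t)" "integrable unit_interval (\<lambda>t. g2 t * \<phi> t)"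
    using assms by (auto intro: L2_interval_integrable_mult)
  then show "(LINT t|unit_interval. (f1 t - f2 t) * \<phi>' t) = - (LINT t|unit_interval. (g1 t - g2 t) * \<phi> t)"
    using assms(1,2) t by (simp add: left_diff_distrib has_weak_deriv_def)
qed

lemma AE_unit_interval_interior: "AE t in unit_interval. 0 < t \<and> t < 1"
proof (rule AE_I')
  show "{0, 1} \<in> null_sets unit_interval"
    by (subst null_sets_restrict_space) (auto intro: negligible_iff_null_sets[THEN iffD1])
  show "{t \<in> space unit_interval. \<not> (0 < t \<and> t < 1)} \<subseteq> {0, 1}" by auto
qed

lemma unit_integral_indicator_interior:
  fixes h :: "real \<Rightarrow> real"
  assumes "h \<in> borel_measurable unit_interval"
  shows "(LINT t|unit_interval. indicator {0<..<1} t * h t) = (LINT t|unit_interval. h t)"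
proof (rule integral_cong_AE)
  show "(\<lambda>t. indicator {0<..<1} t * h t) \<in> borel_measurable unit_interval"
    using borel_measurable_indicator_unit_interval[of "{0<..<1}"] assms by (intro borel_measurable_times) auto
  show "h \<in> borel_measurable unit_interval" by fact
  show "AE t in unit_interval. indicator {0<..<1} t * h t = h t"
    using AE_unit_interval_interior by eventually_elim auto
qed

text \<open>
  The Cauchy--Schwarz inequality on a set of measure at most one, read off from the square of \<open>h - c\<close> on
  \<open>A\<close>, where \<open>c\<close> is the integral of \<open>h\<close> over \<open>A\<close>.
\<close>

lemma unit_integral_indicator_square_le:
  assumes h: "L2_interval h" and A: "A \<in> sets borel"
  shows "(LINT t|unit_interval. indicator A t * h t)\<^sup>2 \<le> (LINT t|unit_interval. (h t)\<^sup>2)"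
proof -
  define c where "c = (LINT t|unit_interval. indicator A t * h t)"
  have L: "L2_interval (\<lambda>t. indicator A t * h t)" by (rule L2_interval_indicator[OF h A])
  have int: "integrable unit_interval (\<lambda>t. (h t)\<^sup>2)" "integrable unit_interval (\<lambda>t. indicator A t * h t)"
    using L2_interval_integrable_square[OF h] L2_interval_integrable[OF L] by auto
  have c1: "integrable unit_interval (\<lambda>_. c\<^sup>2)" "(LINT t|unit_interval. c\<^sup>2) = c\<^sup>2"
    using L2_interval_integrable[OF L2_interval_continuous[of "\<lambda>_. c\<^sup>2"]]
    by (auto simp: measure_restrict_space)
  have "0 \<le> (LINT t|unit_interval. (h t)\<^sup>2 - 2 * c * (indicator A t * h t) + c\<^sup>2)"
  proof (rule Bochner_Integration.integral_nonneg)
    fix t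
    show "0 \<le> (h t)\<^sup>2 - 2 * c * (indicator A t * h t) + c\<^sup>2"
      using zero_le_power2[of "h t - c"] by (simp add: indicator_def power2_diff mult_ac)
  qed
  also have "\<dots> = (LINT t|unit_interval. (h t)\<^sup>2) - 2 * c * c + c\<^sup>2"
    using int c1 by (simp add: c_def)
  finally show ?thesis by (simp add: c_def power2_eq_square)
qed

lemma weak_deriv_increment:
  assumes "continuous_on {0..1} f" "L2_interval g" "has_weak_deriv f g" "0 \<le> x" "x < y" "y \<le> 1"
  shows "(LINT t|unit_interval. indicator {x<..<y} t * g t) = f y - f x"
  using weak_deriv_by_parts[OF assms, of "\<lambda>_. 1" "\<lambda>_. 0"] by simp

lemma weak_deriv_increment_square_le:
  assumes "continuous_on {0..1} f" "L2_interval g" "has_weak_deriv f g" "x \<in> {0..1}" "y \<in> {0..1}"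
  shows "(f y - f x)\<^sup>2 \<le> (LINT t|unit_interval. (g t)\<^sup>2)"
proof -
  have *: "(f y - f x)\<^sup>2 \<le> (LINT t|unit_interval. (g t)\<^sup>2)" if "x < y" "x \<in> {0..1}" "y \<in> {0..1}" for x y
    using unit_integral_indicator_square_le[OF assms(2), of "{x<..<y}"] weak_deriv_increment[OF assms(1-3), of x y] that
    by simp
  show ?thesis
    using *[of x y] *[of y x] assms(4,5) by (cases x y rule: linorder_cases) (auto simp: power2_commute)
qed

text \<open>
  The Borel sets over which \<open>h\<close> integrates to zero form a Dynkin system that contains the intervals,
  hence all Borel sets.  The set where \<open>h\<close> is positive is Lebesgue measurable, so up to a null set it
  is one of them.
\<close>

lemma AE_zero_of_interval_integrals:
  fixes h :: "real \<Rightarrow> real"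
  assumes h: "L2_interval h"
    and zero: "\<And>x y. 0 \<le> x \<Longrightarrow> x < y \<Longrightarrow> y \<le> 1 \<Longrightarrow> (LINT t|unit_interval. indicator {x<..<y} t * h t) = 0"
  shows "AE t in unit_interval. h t = 0"
proof -
  have int: "integrable unit_interval h" by (rule L2_interval_integrable[OF h])
  have setint: "set_integrable unit_interval A h" if "A \<in> sets borel" for A
    using L2_interval_integrable[OF L2_interval_indicator[OF h that]] by (simp add: set_integrable_def)
  have total: "(LINT t|unit_interval. h t) = 0"
    using zero[of 0 1] unit_integral_indicator_interior[OF L2_interval_borel[OF h]] by simp
  have gen: "(LINT t|unit_interval. indicator {a<..<b} t * h t) = 0" for a b
  proof -
    have "(LINT t|unit_interval. indicator {a<..<b} t * h t)
        = (LINT t|unit_interval. indicator {max a 0<..<min b 1} t * h t)"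
    proof (rule integral_cong_AE)
      show "AE t in unit_interval. indicator {a<..<b} t * h t = indicator {max a 0<..<min b 1} t * h t"
        using AE_unit_interval_interior by eventually_elim (auto simp: indicator_def)
    qed (auto intro!: L2_interval_borel L2_interval_indicator h)
    also have "\<dots> = 0"
    proof (cases "max a 0 < min b 1")
      case True
      then show ?thesis by (intro zero) auto
    next
      case False
      then have "{max a 0<..<min b 1} = {}" by auto
      then show ?thesis by simp
    qed
    finally show ?thesis .
  qed
  have borel_zero: "(LINT t|unit_interval. indicator A t * h t) = 0" if A: "A \<in> sets borel" for A
  proof -
    let ?G = "range (\<lambda>(a, b). {a<..<b::real})"
    have sets_borel: "sets borel = sigma_sets UNIV ?G"
      by (simp add: borel_eq_box sets_measure_of box_real(1)[abs_def])
    have "Int_stable ?G" "?G \<subseteq> Pow UNIV" "A \<in> sigma_sets UNIV ?G"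
      using A sets_borel by (auto simp: Int_stable_def)
    then show ?thesis
    proof (induction rule: sigma_sets_induct_disjoint)
      case (basic A)
      then show ?case using gen by auto
    next
      case empty
      then show ?case by simp
    next
      case (compl A)
      then have "A \<in> sets borel" by (simp add: sets_borel)
      then have "integrable unit_interval (\<lambda>t. indicator A t * h t)"
        using setint by (simp add: set_integrable_def)
      moreover have "indicator (UNIV - A) t * h t = h t - indicator A t * h t" for t
        by (simp add: indicator_def)
      ultimately show ?case using int total compl by simp
    next
      case (union A)
      then have A: "A i \<in> sets borel" for i by (auto simp: sets_borel)
      have "A i \<inter> {0..1} \<in> sets unit_interval" for i
        using A[of i] by (auto simp: sets_restrict_space)
      moreover have "(A i \<inter> {0..1}) \<inter> (A j \<inter> {0..1}) = {}" if "i \<noteq> j" for i j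
        using union(1) that by (auto simp: disjoint_family_on_def)
      moreover have "set_integrable unit_interval (\<Union>i. A i \<inter> {0..1}) h"
        using A by (intro setint) auto
      ultimately have "(LINT t:(\<Union>i. A i \<inter> {0..1})|unit_interval. h t)
          = (\<Sum>i. (LINT t:(A i \<inter> {0..1})|unit_interval. h t))"
        by (intro lebesgue_integral_countable_add)
      moreover have "(LINT t:(B \<inter> {0..1})|unit_interval. h t) = (LINT t|unit_interval. indicator B t * h t)" for B
        unfolding set_lebesgue_integral_def
        by (rule Bochner_Integration.integral_cong) (auto simp: indicator_def)
      moreover have "(\<Union>i. A i \<inter> {0..1}) = (\<Union>i. A i) \<inter> {0..1}" by blast
      ultimately show ?case using union by simp
    qed
  qed
  have nonpos: "AE t in unit_interval. k t \<le> 0"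
    if k: "L2_interval k" and kz: "\<And>A. A \<in> sets borel \<Longrightarrow> (LINT t|unit_interval. indicator A t * k t) = 0" for k
  proof -
    define P where "P = {t \<in> {0..1}. k t > 0}"
    have "{t \<in> space unit_interval. k t > 0} \<in> sets unit_interval"
      using L2_interval_borel[OF k] by (rule borel_measurable_less[OF borel_measurable_const])
    then have "P \<in> sets lebesgue"
      by (auto simp: P_def sets_restrict_space_iff)
    then obtain C T where CT: "fsigma C" "T \<in> null_sets lebesgue" "C \<union> T = P" "disjnt C T"
      by (rule lebesgue_set_almost_fsigma)
    have C: "C \<in> sets borel" using CT(1) by (auto elim!: fsigma.cases intro: borel_closed)
    have int: "integrable unit_interval (\<lambda>t. indicator C t * k t)"
      by (rule L2_interval_integrable[OF L2_interval_indicator[OF k C]])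
    have "AE t in unit_interval. indicator C t * k t = 0"
    proof (rule integral_nonneg_eq_0_iff_AE[THEN iffD1, OF int])
      show "AE t in unit_interval. 0 \<le> indicator C t * k t"
      proof (intro always_eventually allI)
        have "C \<subseteq> P" using CT(3) by blast
        then show "0 \<le> indicator C t * k t" for t by (auto simp: indicator_def P_def)
      qed
    qed (rule kz[OF C])
    moreover have "AE t in unit_interval. t \<notin> T"
    proof (rule AE_I')
      have "T \<subseteq> {0..1}" using CT(3) by (auto simp: P_def)
      then show "T \<in> null_sets unit_interval"
        using CT(2) by (subst null_sets_restrict_space) auto
    qed auto
    moreover have "AE t in unit_interval. t \<in> {0..1}"
      using AE_unit_interval_interior by eventually_elim auto
    ultimately show ?thesis
    proof eventually_elim
      case (elim t)
      have "t \<notin> P"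
      proof
        assume "t \<in> P"
        then have "t \<in> C" "k t > 0" using CT(3) elim by (auto simp: P_def)
        then show False using elim by simp
      qed
      then show ?case using elim by (simp add: P_def not_less)
    qed
  qed
  have "AE t in unit_interval. h t \<le> 0" by (rule nonpos[OF h borel_zero])
  moreover have "AE t in unit_interval. -1 * h t \<le> 0"
    by (rule nonpos[OF L2_interval_cmult[OF h]]) (simp add: borel_zero)
  ultimately show ?thesis by eventually_elim auto
qed

text \<open>
  The energy of a trial function is defined through an arbitrarily chosen weak derivative; by uniqueness
  the classical derivative computes it.
\<close>

lemma weak_deriv_unique_AE:
  assumes f: "continuous_on {0..1} f" and g: "L2_interval g1" "L2_interval g2"
    "has_weak_deriv f g1" "has_weak_deriv f g2"
  shows "AE t in unit_interval. g1 t = g2 t"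
proof -
  have "AE t in unit_interval. g1 t - g2 t = 0"
  proof (rule AE_zero_of_interval_integrals)
    show d: "L2_interval (\<lambda>t. g1 t - g2 t)" by (rule L2_interval_diff[OF g(1,2)])
    have Lf: "L2_interval f" by (rule L2_interval_continuous[OF f])
    have "has_weak_deriv (\<lambda>t. f t - f t) (\<lambda>t. g1 t - g2 t)"
      by (rule has_weak_deriv_diff) (use g Lf in auto)
    then have "has_weak_deriv (\<lambda>_. 0) (\<lambda>t. g1 t - g2 t)" by simp
    then show "(LINT t|unit_interval. indicator {x<..<y} t * (g1 t - g2 t)) = 0"
      if "0 \<le> x" "x < y" "y \<le> 1" for x y
      using weak_deriv_increment[OF _ d _ that, of "\<lambda>_. 0"] by simp
  qed
  then show ?thesis by simp
qed

section \<open>The energy of one edge\<close>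

text \<open>
  The solution of \<open>s'' = - \<theta>\<^sup>2 s\<close> on the unit interval with \<open>s(0) = a\<close> and \<open>s(1) = b\<close>.
\<close>

definition sine_profile :: "real \<Rightarrow> real \<Rightarrow> real \<Rightarrow> real \<Rightarrow> real" where
  "sine_profile \<theta> a b t = (a * sin (\<theta> * (1 - t)) + b * sin (\<theta> * t)) / sin \<theta>"

definition sine_profile_deriv :: "real \<Rightarrow> real \<Rightarrow> real \<Rightarrow> real \<Rightarrow> real" where
  "sine_profile_deriv \<theta> a b t = \<theta> * (b * cos (\<theta> * t) - a * cos (\<theta> * (1 - t))) / sin \<theta>"

lemma has_real_derivative_sine_profile:
  "(sine_profile \<theta> a b has_real_derivative sine_profile_deriv \<theta> a b t) (at t)"
  unfolding sine_profile_def[abs_def] sine_profile_deriv_def divide_inverse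
  by (auto intro!: derivative_eq_intros simp: algebra_simps)

lemma has_real_derivative_sine_profile_deriv:
  "(sine_profile_deriv \<theta> a b has_real_derivative - \<theta>\<^sup>2 * sine_profile \<theta> a b t) (at t)"
  unfolding sine_profile_def sine_profile_deriv_def[abs_def] divide_inverse
  by (auto intro!: derivative_eq_intros simp: algebra_simps power2_eq_square)

lemma continuous_sine_profile: "continuous_on A (sine_profile \<theta> a b)"
  using DERIV_isCont[OF has_real_derivative_sine_profile] by (auto intro: continuous_at_imp_continuous_on)

lemma continuous_sine_profile_deriv: "continuous_on A (sine_profile_deriv \<theta> a b)"
  using DERIV_isCont[OF has_real_derivative_sine_profile_deriv] by (auto intro: continuous_at_imp_continuous_on)

lemma sine_profile_ends:
  assumes "sin \<theta> \<noteq> 0"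
  shows "sine_profile \<theta> a b 0 = a" "sine_profile \<theta> a b 1 = b"
  using assms by (auto simp: sine_profile_def)

lemma has_weak_deriv_sine_profile: "has_weak_deriv (sine_profile \<theta> a b) (sine_profile_deriv \<theta> a b)"
  by (rule C1_has_weak_deriv[OF has_real_derivative_sine_profile continuous_sine_profile_deriv])

lemma sine_profile_abs_le:
  assumes "0 < \<theta>" "\<theta> < pi / 2" "t \<in> {0..1}"
  shows "\<bar>sine_profile \<theta> a b t\<bar> \<le> \<bar>a\<bar> + \<bar>b\<bar>"
proof -
  have pos: "sin \<theta> > 0" using assms by (intro sin_gt_zero) auto
  have *: "0 \<le> sin (\<theta> * x) \<and> sin (\<theta> * x) \<le> sin \<theta>" if "x \<in> {0..1}" for x
  proof -
    have "0 \<le> \<theta> * x" "\<theta> * x \<le> \<theta>" "\<theta> \<le> pi / 2" using that assms by (auto simp: mult_left_le)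
    then show ?thesis by (intro conjI sin_ge_zero sin_monotone_2pi_le) linarith+
  qed
  have "\<bar>sin (\<theta> * (1 - t))\<bar> \<le> sin \<theta>" "\<bar>sin (\<theta> * t)\<bar> \<le> sin \<theta>"
    using *[of "1 - t"] *[of t] assms(3) by auto
  then have "\<bar>a * sin (\<theta> * (1 - t))\<bar> \<le> \<bar>a\<bar> * sin \<theta>" "\<bar>b * sin (\<theta> * t)\<bar> \<le> \<bar>b\<bar> * sin \<theta>"
    by (auto simp: abs_mult intro: mult_left_mono)
  then have "\<bar>a * sin (\<theta> * (1 - t)) + b * sin (\<theta> * t)\<bar> \<le> (\<bar>a\<bar> + \<bar>b\<bar>) * sin \<theta>"
    unfolding distrib_right by linarith
  then show ?thesis
    using pos by (simp add: sine_profile_def divide_le_eq)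
qed

lemma sine_profile_ge:
  assumes "0 < \<theta>" "\<theta> < pi / 2" "t \<in> {0..1}" "0 \<le> m" "m \<le> a" "m \<le> b"
  shows "m \<le> sine_profile \<theta> a b t"
proof -
  have pos: "sin \<theta> > 0" using assms by (intro sin_gt_zero) auto
  have nonneg: "0 \<le> sin (\<theta> * x)" if "x \<in> {0..1}" for x
  proof -
    have "0 \<le> \<theta> * x" "\<theta> * x \<le> \<theta>" "\<theta> \<le> pi / 2" using that assms by (auto simp: mult_left_le)
    then show ?thesis by (intro sin_ge_zero) linarith+
  qed
  have t: "0 \<le> sin (\<theta> * (1 - t))" "0 \<le> sin (\<theta> * t)"
    using nonneg[of "1 - t"] nonneg[of t] assms(3) by auto
  have "sin \<theta> = sin (\<theta> * (1 - t) + \<theta> * t)" by (simp add: algebra_simps)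
  also have "\<dots> = sin (\<theta> * (1 - t)) * cos (\<theta> * t) + cos (\<theta> * (1 - t)) * sin (\<theta> * t)"
    by (rule sin_add)
  also have "\<dots> \<le> sin (\<theta> * (1 - t)) * 1 + 1 * sin (\<theta> * t)"
    using t by (intro add_mono mult_left_mono mult_right_mono cos_le_one) auto
  finally have "m * sin \<theta> \<le> m * sin (\<theta> * (1 - t)) + m * sin (\<theta> * t)"
    using mult_left_mono[OF _ assms(4)] by (fastforce simp: distrib_left)
  also have "\<dots> \<le> a * sin (\<theta> * (1 - t)) + b * sin (\<theta> * t)"
    using t assms by (intro add_mono mult_right_mono) auto
  finally show ?thesis using pos by (simp add: sine_profile_def le_divide_eq)
qed

text \<open>
  The integral of \<open>g s' - \<theta>\<^sup>2 f s\<close> depends only on the end values of \<open>f\<close>, because integration by parts moves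
  the derivative to \<open>s'\<close> and \<open>s'' = - \<theta>\<^sup>2 s\<close>.  Since \<open>f\<close> and \<open>s\<close> agree at the end points, this integral is the
  same boundary term \<open>B\<close> for \<open>f\<close> as for \<open>s\<close> in place of \<open>f\<close>, and expanding the squares leaves one copy of \<open>B\<close>.
\<close>

lemma interval_energy_identity:
  fixes f g :: "real \<Rightarrow> real" and \<theta> :: real
  assumes f: "continuous_on {0..1} f" and g: "L2_interval g" and fg: "has_weak_deriv f g"
    and \<theta>: "sin \<theta> \<noteq> 0"
  defines "s \<equiv> sine_profile \<theta> (f 0) (f 1)" and "s' \<equiv> sine_profile_deriv \<theta> (f 0) (f 1)"
  shows "(LINT t|unit_interval. (g t)\<^sup>2) - \<theta>\<^sup>2 * (LINT t|unit_interval. (f t)\<^sup>2)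
    = \<theta> / sin \<theta> * (cos \<theta> * ((f 0)\<^sup>2 + (f 1)\<^sup>2) - 2 * f 0 * f 1)
      + (LINT t|unit_interval. (g t - s' t)\<^sup>2) - \<theta>\<^sup>2 * (LINT t|unit_interval. (f t - s t)\<^sup>2)"
proof -
  define B where "B = f 1 * s' 1 - f 0 * s' 0"
  have cs: "continuous_on A s" "continuous_on A s'" for A
    unfolding s_def s'_def by (rule continuous_sine_profile continuous_sine_profile_deriv)+
  have L: "L2_interval f" "L2_interval s" "L2_interval s'"
    by (intro L2_interval_continuous f cs)+
  note I = L2_interval_integrable_mult[OF L(1) L(2)] L2_interval_integrable_mult[OF g L(3)]
    L2_interval_integrable_square[OF L(1)] L2_interval_integrable_square[OF L(2)]
    L2_interval_integrable_square[OF L(3)] L2_interval_integrable_square[OF g]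
  have "(LINT t|unit_interval. indicator {0<..<1} t * (f t * (- \<theta>\<^sup>2 * s t) + g t * s' t)) = B"
    unfolding B_def s_def s'_def
    by (rule weak_deriv_by_parts[OF f g fg])
      (auto intro!: has_real_derivative_sine_profile_deriv[simplified] continuous_intros continuous_sine_profile)
  moreover have "(LINT t|unit_interval. indicator {0<..<1} t * (f t * (- \<theta>\<^sup>2 * s t) + g t * s' t))
      = (LINT t|unit_interval. g t * s' t - \<theta>\<^sup>2 * (f t * s t))"
  proof (subst unit_integral_indicator_interior)
    show "(\<lambda>t. f t * (- \<theta>\<^sup>2 * s t) + g t * s' t) \<in> borel_measurable unit_interval"
      using g L by (intro borel_measurable_add borel_measurable_times borel_measurable_const L2_interval_borel) auto
  qed (simp add: mult_ac)
  ultimately have cross: "(LINT t|unit_interval. g t * s' t) - \<theta>\<^sup>2 * (LINT t|unit_interval. f t * s t) = B"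
    using I by simp
  have "(LINT t|unit_interval. (s' t)\<^sup>2 - \<theta>\<^sup>2 * (s t)\<^sup>2) = s 1 * s' 1 - s 0 * s' 0"
  proof (rule unit_integral_FTC[where F="\<lambda>t. s t * s' t"])
    show "((\<lambda>t. s t * s' t) has_real_derivative (s' t)\<^sup>2 - \<theta>\<^sup>2 * (s t)\<^sup>2) (at t)" for t
      unfolding s_def s'_def
      by (rule DERIV_mult'[OF has_real_derivative_sine_profile has_real_derivative_sine_profile_deriv, THEN DERIV_cong])
        (simp add: power2_eq_square)
  qed (intro continuous_intros cs)
  also have "\<dots> = B" using \<theta> by (simp add: B_def s_def sine_profile_ends)
  finally have self: "(LINT t|unit_interval. (s' t)\<^sup>2) - \<theta>\<^sup>2 * (LINT t|unit_interval. (s t)\<^sup>2) = B"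
    using I by simp
  have h_eq: "(LINT t|unit_interval. (g t - s' t)\<^sup>2)
      = (LINT t|unit_interval. (g t)\<^sup>2) - 2 * (LINT t|unit_interval. g t * s' t) + (LINT t|unit_interval. (s' t)\<^sup>2)"
    using I by (simp add: power2_diff mult.assoc)
  have w_eq: "(LINT t|unit_interval. (f t - s t)\<^sup>2)
      = (LINT t|unit_interval. (f t)\<^sup>2) - 2 * (LINT t|unit_interval. f t * s t) + (LINT t|unit_interval. (s t)\<^sup>2)"
    using I by (simp add: power2_diff mult.assoc)
  have B_eq: "B = \<theta> / sin \<theta> * (cos \<theta> * ((f 0)\<^sup>2 + (f 1)\<^sup>2) - 2 * f 0 * f 1)"
    using \<theta> by (simp add: B_def s'_def sine_profile_deriv_def field_simps power2_eq_square)
  show ?thesis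
    unfolding h_eq w_eq B_eq[symmetric] using cross self by (simp add: algebra_simps)
qed

text \<open>
  The difference \<open>f - s\<close> vanishes at 0, so its square is bounded at every point by its Dirichlet
  integral \<open>H\<close>.  Hence \<open>\<theta>\<^sup>2\<integral>(f - s)\<^sup>2 \<le> H/2\<close>, and half of \<open>H\<close> remains to bound \<open>f - s\<close> pointwise.
\<close>

lemma interval_energy_lower_bound:
  fixes f g :: "real \<Rightarrow> real" and \<theta> :: real
  assumes f: "continuous_on {0..1} f" and g: "L2_interval g" and fg: "has_weak_deriv f g"
    and \<theta>: "sin \<theta> \<noteq> 0" "\<theta>\<^sup>2 \<le> 1 / 2" and t: "t \<in> {0..1}"
  shows "\<theta> / sin \<theta> * (cos \<theta> * ((f 0)\<^sup>2 + (f 1)\<^sup>2) - 2 * f 0 * f 1)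
      + (f t - sine_profile \<theta> (f 0) (f 1) t)\<^sup>2 / 2
    \<le> (LINT t|unit_interval. (g t)\<^sup>2) - \<theta>\<^sup>2 * (LINT t|unit_interval. (f t)\<^sup>2)"
proof -
  define s where "s = sine_profile \<theta> (f 0) (f 1)"
  define s' where "s' = sine_profile_deriv \<theta> (f 0) (f 1)"
  define H where "H = (LINT t|unit_interval. (g t - s' t)\<^sup>2)"
  have cs: "continuous_on {0..1} s" "continuous_on {0..1} s'"
    unfolding s_def s'_def by (rule continuous_sine_profile continuous_sine_profile_deriv)+
  have L: "L2_interval f" "L2_interval s" "L2_interval s'"
    by (intro L2_interval_continuous f cs)+
  have w: "has_weak_deriv (\<lambda>t. f t - s t) (\<lambda>t. g t - s' t)"
    unfolding s_def s'_def
    by (rule has_weak_deriv_diff[OF fg has_weak_deriv_sine_profile]) (use L g s_def s'_def in auto)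
  have cw: "continuous_on {0..1} (\<lambda>t. f t - s t)" by (intro continuous_intros f cs)
  have wH: "(f t - s t)\<^sup>2 \<le> H" if "t \<in> {0..1}" for t
    using weak_deriv_increment_square_le[OF cw L2_interval_diff[OF g L(3)] w, of 0 t] that \<theta>
    by (simp add: H_def s_def sine_profile_ends)
  have "(LINT t|unit_interval. (f t - s t)\<^sup>2) \<le> (LINT t|unit_interval. H)"
    using wH by (intro integral_mono L2_interval_integrable_square L2_interval_diff L
      L2_interval_integrable L2_interval_continuous) auto
  also have "\<dots> = H" by (simp add: measure_restrict_space)
  finally have "\<theta>\<^sup>2 * (LINT t|unit_interval. (f t - s t)\<^sup>2) \<le> 1 / 2 * H"
    by (intro mult_mono[OF \<theta>(2)]) auto
  then have "H - \<theta>\<^sup>2 * (LINT t|unit_interval. (f t - s t)\<^sup>2) \<ge> (f t - s t)\<^sup>2 / 2"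
    using wH[OF t] by linarith
  then show ?thesis
    using interval_energy_identity[OF f g fg \<theta>(1)] by (simp add: s_def s'_def H_def)
qed

text \<open>
  Makes the squares of the vertex values of an \<open>H\<^sup>1\<close> function summable over the tree.
\<close>

lemma trace_square_le:
  assumes f: "continuous_on {0..1} f" and g: "L2_interval g" and fg: "has_weak_deriv f g"
    and x: "x \<in> {0..1}"
  shows "(f x)\<^sup>2 \<le> 2 * (LINT t|unit_interval. (g t)\<^sup>2 + (f t)\<^sup>2)"
proof -
  define H where "H = (LINT t|unit_interval. (g t)\<^sup>2)"
  have Lf: "L2_interval f" by (rule L2_interval_continuous[OF f])
  have c: "integrable unit_interval (\<lambda>_. c)" for c :: real
    by (intro L2_interval_integrable L2_interval_continuous) auto
  note I = L2_interval_integrable_square[OF Lf] L2_interval_integrable_square[OF g]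
  have "(f x)\<^sup>2 = (LINT t|unit_interval. (f x)\<^sup>2)" by (simp add: measure_restrict_space)
  also have "\<dots> \<le> (LINT t|unit_interval. 2 * H + 2 * (f t)\<^sup>2)"
  proof (rule integral_mono)
    fix t assume "t \<in> space unit_interval"
    then have "(f x - f t)\<^sup>2 \<le> H"
      using weak_deriv_increment_square_le[OF f g fg, of t x] x by (simp add: H_def)
    moreover have "(f x)\<^sup>2 \<le> 2 * (f x - f t)\<^sup>2 + 2 * (f t)\<^sup>2"
      using zero_le_power2[of "f x - 2 * f t"] by (simp add: power2_eq_square algebra_simps)
    ultimately show "(f x)\<^sup>2 \<le> 2 * H + 2 * (f t)\<^sup>2" by linarith
  qed (use I c in auto)
  also have "\<dots> = 2 * H + 2 * (LINT t|unit_interval. (f t)\<^sup>2)"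
    using I c by (simp add: measure_restrict_space)
  also have "\<dots> = 2 * (LINT t|unit_interval. (g t)\<^sup>2 + (f t)\<^sup>2)"
    using I by (simp add: H_def)
  finally show ?thesis .
qed

lemma weak_deriv_of_H1:
  assumes "H1_interval f"
  shows "L2_interval (weak_deriv f)" "has_weak_deriv f (weak_deriv f)"
  using assms someI_ex[of "\<lambda>g. L2_interval g \<and> has_weak_deriv f g"]
  by (auto simp: H1_interval_def weak_deriv_def)

lemma sine_profile_zero: "sine_profile \<theta> 0 0 = (\<lambda>_. 0)"
  by (auto simp: sine_profile_def)

lemma H1_interval_sine_profile: "H1_interval (sine_profile \<theta> a b)"
  unfolding H1_interval_def
  using has_weak_deriv_sine_profile L2_interval_continuous[OF continuous_sine_profile]
    L2_interval_continuous[OF continuous_sine_profile_deriv] by blast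

lemma energy_sine_profile:
  "(LINT t|unit_interval. (weak_deriv (sine_profile \<theta> a b) t)\<^sup>2) = (LINT t|unit_interval. (sine_profile_deriv \<theta> a b t)\<^sup>2)"
proof (rule integral_cong_AE)
  note W = weak_deriv_of_H1[OF H1_interval_sine_profile, of \<theta> a b]
  have L: "L2_interval (sine_profile_deriv \<theta> a b)" by (rule L2_interval_continuous[OF continuous_sine_profile_deriv])
  show "AE t in unit_interval. (weak_deriv (sine_profile \<theta> a b) t)\<^sup>2 = (sine_profile_deriv \<theta> a b t)\<^sup>2"
    using weak_deriv_unique_AE[OF continuous_sine_profile W(1) L W(2) has_weak_deriv_sine_profile]
    by eventually_elim simp
  show "(\<lambda>t. (weak_deriv (sine_profile \<theta> a b) t)\<^sup>2) \<in> borel_measurable unit_interval"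
    "(\<lambda>t. (sine_profile_deriv \<theta> a b t)\<^sup>2) \<in> borel_measurable unit_interval"
    using L2_interval_borel[OF W(1)] L2_interval_borel[OF L] by auto
qed

text \<open>
  On the profile itself the comparison of \<open>interval_energy_identity\<close> has no remainder.
\<close>

lemma defect_sine_profile:
  assumes "sin \<theta> \<noteq> 0"
  shows "(LINT t|unit_interval. (sine_profile_deriv \<theta> a b t)\<^sup>2) - \<theta>\<^sup>2 * (LINT t|unit_interval. (sine_profile \<theta> a b t)\<^sup>2)
    = \<theta> / sin \<theta> * (cos \<theta> * (a\<^sup>2 + b\<^sup>2) - 2 * a * b)"
  using interval_energy_identity[OF continuous_sine_profile
      L2_interval_continuous[OF continuous_sine_profile_deriv] has_weak_deriv_sine_profile assms, of \<theta> a b]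
  by (simp add: sine_profile_ends[OF assms])

section \<open>Depth, parents and children in a tree\<close>

lemma adj_sym: "(v, w) \<in> adj E \<Longrightarrow> (w, v) \<in> adj E"
  by (auto simp: adj_def)

lemma adj_Field: "(v, w) \<in> adj E \<Longrightarrow> v \<in> Field E" "(v, w) \<in> adj E \<Longrightarrow> w \<in> Field E"
  by (auto simp: adj_def Field_def)

text \<open>
  A tree in which an arbitrary vertex \<open>p\<close> is singled out.  The choice of \<open>p\<close> is independent of the
  degrees, so a binary tree is studied with each of its vertices in this role.
\<close>

locale rooted_tree =
  fixes E :: "('v \<times> 'v) set" and p :: 'v
  assumes tree: "is_tree E" and root: "p \<in> Field E" and finite_nbrs: "\<And>v. finite {w. (v, w) \<in> adj E}"
begin

definition depth :: "'v \<Rightarrow> nat" where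
  "depth v = (LEAST n. (p, v) \<in> adj E ^^ n)"

lemma asym_E: "asym E" and connected: "v \<in> Field E \<Longrightarrow> w \<in> Field E \<Longrightarrow> (v, w) \<in> (adj E)\<^sup>*"
  and no_cycle: "\<not> is_cycle E P"
  using tree unfolding is_tree_def by blast+

lemma adj_irrefl: "(v, v) \<notin> adj E"
  using asymD[OF asym_E, of v v] by (auto simp: adj_def)

lemma asym_edges: "(v, w) \<in> E \<Longrightarrow> (w, v) \<notin> E"
  by (rule asymD[OF asym_E])

lemma path_of_depth_length: "v \<in> Field E \<Longrightarrow> (p, v) \<in> adj E ^^ depth v"
  unfolding depth_def by (rule LeastI_ex) (use connected[OF root] in \<open>simp add: rtrancl_power\<close>)

lemma depth_le: "(p, v) \<in> adj E ^^ n \<Longrightarrow> depth v \<le> n"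
  unfolding depth_def by (rule Least_le)

lemma depth_root [simp]: "depth p = 0"
  using depth_le[of p 0] by simp

lemma depth_eq_0: "v \<in> Field E \<Longrightarrow> depth v = 0 \<longleftrightarrow> v = p"
  using path_of_depth_length[of v] by auto

lemma depth_step:
  assumes "(v, w) \<in> adj E"
  shows "depth w \<le> Suc (depth v)"
  using path_of_depth_length[OF adj_Field(1)[OF assms]] assms by (intro depth_le) auto

lemma parent_exists:
  assumes "v \<in> Field E" "v \<noteq> p"
  obtains w where "(v, w) \<in> adj E" "depth v = Suc (depth w)"
proof -
  obtain n where n: "depth v = Suc n" using depth_eq_0[OF assms(1)] assms(2) by (cases "depth v") auto
  then obtain w where w: "(p, w) \<in> adj E ^^ n" "(w, v) \<in> adj E"
    using path_of_depth_length[OF assms(1)] by auto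
  then have "depth v = Suc (depth w)" using depth_le[OF w(1)] depth_step[OF w(2)] n by simp
  then show ?thesis using that adj_sym[OF w(2)] by blast
qed

text \<open>
  Two distinct vertices of the same depth are not joined by a simple path all of whose vertices have at
  least that depth.  Otherwise attach the parents of the two ends: if the parents coincide this closes a cycle,
  and if not it is a longer path of the same kind one level closer to the root.  At the root itself
  there is only one vertex.  The uniqueness of parents and the absence of edges within a level are the
  cases of paths with three and with two vertices.
\<close>

lemma no_path_above_level:
  assumes "distinct P" "length P \<ge> 2" "successively (\<lambda>v w. (v, w) \<in> adj E) P"
    and "depth (hd P) = n" "depth (last P) = n" "\<forall>v\<in>set P. n \<le> depth v"
  shows False
  using assms
proof (induction n arbitrary: P)
  case (0 P)
  obtain x y Q where P: "P = x # y # Q" using 0(2) by (cases P; cases "tl P") auto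
  then have xy: "(x, y) \<in> adj E" using 0(3) by simp
  have "last P \<in> Field E"
  proof -
    have "(last (butlast P), last P) \<in> adj E"
      using 0(3) P append_butlast_last_id[of P] 
      by (metis butlast.simps(2) list.distinct(1) successively_append_iff list.sel(1))
    then show ?thesis by (rule adj_Field)
  qed
  then have "last P = p" using 0(5) depth_eq_0 by blast
  moreover have "x = p" using 0(4) P depth_eq_0 adj_Field(1)[OF xy] by simp
  ultimately show False using 0(1) P by (auto split: if_splits)
next
  case (Suc n P)
  obtain x y Q where P: "P = x # y # Q" using Suc(3) by (cases P; cases "tl P") auto
  then have xy: "(x, y) \<in> adj E" using Suc(4) by simp
  have x: "x \<in> Field E" "x \<noteq> p" using Suc(5) P adj_Field(1)[OF xy] by auto
  have "(last (butlast P), last P) \<in> adj E"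
    using Suc(4) P append_butlast_last_id[of P] 
    by (metis butlast.simps(2) list.distinct(1) successively_append_iff list.sel(1))
  then have z: "last P \<in> Field E" "last P \<noteq> p"
    using Suc(6) by (auto intro: adj_Field simp del: depth_root) (metis depth_root nat.distinct(1))
  obtain x' where x': "(x, x') \<in> adj E" "depth x' = n"
    using parent_exists[OF x] Suc(5) P by (metis list.sel(1) nat.inject)
  obtain z' where z': "(last P, z') \<in> adj E" "depth z' = n"
    using parent_exists[OF z] Suc(6) by (metis nat.inject)
  have new: "x' \<notin> set P" "z' \<notin> set P" using Suc(7) x' z' by (metis not_less_eq_eq order_refl)+
  show False
  proof (cases "x' = z'")
    case True
    let ?q = "x' # P"
    have succ: "successively (\<lambda>v w. (v, w) \<in> adj E) ?q"
      using Suc(4) P adj_sym[OF x'(1)] by simp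
    have "is_cycle E ?q"
      unfolding is_cycle_def
    proof (intro conjI allI impI)
      show "3 \<le> length ?q" "distinct ?q" using P new Suc(2) by auto
      fix i assume i: "i < length ?q"
      show "(?q ! i, ?q ! (Suc i mod length ?q)) \<in> adj E"
      proof (cases "Suc i = length ?q")
        case True
        then have "?q ! i = last P" "?q ! (Suc i mod length ?q) = x'"
          using P by (auto simp: last_conv_nth)
        then show ?thesis using z' \<open>x' = z'\<close> by simp
      next
        case False
        then have "Suc i < length ?q" using i by simp
        then show ?thesis using succ by (simp add: successively_conv_nth)
      qed
    qed
    then show False using no_cycle by blast
  next
    case False
    show False
    proof (rule Suc.IH[of "x' # P @ [z']"])
      show "successively (\<lambda>v w. (v, w) \<in> adj E) (x' # P @ [z'])"
      proof -
        have "successively (\<lambda>v w. (v, w) \<in> adj E) (x' # P)" using Suc(4) P adj_sym[OF x'(1)] by simp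
        moreover have "last (x' # P) = last P" using P by simp
        ultimately show ?thesis
          using z'(1) successively_append_iff[of _ "x' # P" "[z']"] by simp
      qed
      show "\<forall>v\<in>set (x' # P @ [z']). n \<le> depth v" using Suc(7) x' z' by auto
    qed (use Suc(2) new False x' z' P in auto)
  qed
qed

lemma depth_adj_neq:
  assumes "(v, w) \<in> adj E"
  shows "depth v \<noteq> depth w"
proof
  assume "depth v = depth w"
  then show False
    using no_path_above_level[of "[v, w]" "depth v"] assms adj_irrefl by auto
qed

lemma parent_unique:
  assumes "(v, w) \<in> adj E" "depth v = Suc (depth w)" "(v, w') \<in> adj E" "depth v = Suc (depth w')"
  shows "w = w'"
proof (rule ccontr)
  assume "w \<noteq> w'"
  then show False
    using no_path_above_level[of "[w, v, w']" "depth w"] assms adj_irrefl adj_sym[OF assms(1)] by auto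
qed

definition parent :: "'v \<Rightarrow> 'v" where
  "parent v = (THE w. (v, w) \<in> adj E \<and> depth v = Suc (depth w))"

lemma parent:
  assumes "v \<in> Field E - {p}"
  shows "(v, parent v) \<in> adj E" "depth v = Suc (depth (parent v))"
proof -
  have "\<exists>!w. (v, w) \<in> adj E \<and> depth v = Suc (depth w)"
    using parent_exists[of v] parent_unique[of v] assms by (metis DiffE insertI1)
  from theI'[OF this] show "(v, parent v) \<in> adj E" "depth v = Suc (depth (parent v))"
    unfolding parent_def by auto
qed

lemma parent_eqI:
  assumes "(v, w) \<in> adj E" "depth v = Suc (depth w)"
  shows "parent v = w" "v \<in> Field E - {p}"
proof -
  show v: "v \<in> Field E - {p}" using assms adj_Field by auto
  show "parent v = w" using parent_unique[OF assms] parent[OF v] by simp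
qed

lemma parent_Field: "v \<in> Field E - {p} \<Longrightarrow> parent v \<in> Field E"
  by (rule adj_Field[OF parent(1)])

lemma adj_cases:
  assumes "(v, w) \<in> adj E"
  obtains "v \<in> Field E - {p}" "parent v = w" | "w \<in> Field E - {p}" "parent w = v"
proof -
  have "depth v = Suc (depth w) \<or> depth w = Suc (depth v)"
    using depth_step[OF assms] depth_step[OF adj_sym[OF assms]] depth_adj_neq[OF assms] by linarith
  then show ?thesis using parent_eqI[OF assms] parent_eqI[OF adj_sym[OF assms]] that by blast
qed

text \<open>
  Every edge joins a vertex other than the root to its parent, and it is stored in exactly one of the
  two orientations.
\<close>

definition child_edge :: "'v \<Rightarrow> 'v \<times> 'v" where
  "child_edge v = (if (v, parent v) \<in> E then (v, parent v) else (parent v, v))"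

lemma child_edge_cases:
  assumes "v \<in> Field E - {p}"
  obtains "child_edge v = (v, parent v)" "(v, parent v) \<in> E"
    | "child_edge v = (parent v, v)" "(parent v, v) \<in> E"
  using parent(1)[OF assms] that by (cases "(v, parent v) \<in> E") (auto simp: child_edge_def adj_def)

lemma bij_betw_child_edge: "bij_betw child_edge (Field E - {p}) E"
  unfolding bij_betw_def
proof
  show "inj_on child_edge (Field E - {p})"
  proof (rule inj_onI)
    fix v w assume v: "v \<in> Field E - {p}" and w: "w \<in> Field E - {p}" and eq: "child_edge v = child_edge w"
    then have "v = w \<or> parent v = w \<and> parent w = v"
      by (auto simp: child_edge_def split: if_splits)
    then show "v = w" using parent(2)[OF v] parent(2)[OF w] by auto
  qed
  show "child_edge ` (Field E - {p}) = E"
  proof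
    show "child_edge ` (Field E - {p}) \<subseteq> E"
      by (rule image_subsetI) (metis child_edge_cases)
    show "E \<subseteq> child_edge ` (Field E - {p})"
    proof
      fix e assume e: "e \<in> E"
      obtain v w where vw: "e = (v, w)" by (cases e)
      with e have "(v, w) \<in> adj E" by (simp add: adj_def)
      then show "e \<in> child_edge ` (Field E - {p})"
      proof (cases rule: adj_cases)
        case 1
        then show ?thesis using e vw by (intro image_eqI[of _ _ v]) (auto simp: child_edge_def)
      next
        case 2
        then show ?thesis using e vw asym_edges[of v w]
          by (intro image_eqI[of _ _ w]) (auto simp: child_edge_def)
      qed
    qed
  qed
qed

definition children :: "'v \<Rightarrow> 'v set" where
  "children w = {v \<in> Field E - {p}. parent v = w}"

lemma nbrs_eq:
  assumes "w \<in> Field E"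
  shows "{v. (w, v) \<in> adj E} = children w \<union> (if w = p then {} else {parent w})"
proof (intro set_eqI iffI)
  fix v assume "v \<in> {v. (w, v) \<in> adj E}"
  then have "(w, v) \<in> adj E" by simp
  then show "v \<in> children w \<union> (if w = p then {} else {parent w})"
    by (cases rule: adj_cases) (auto simp: children_def)
next
  fix v assume "v \<in> children w \<union> (if w = p then {} else {parent w})"
  then show "v \<in> {v. (w, v) \<in> adj E}"
    using assms parent(1)[of w] adj_sym[OF parent(1)[of v]] by (auto simp: children_def split: if_splits)
qed

lemma finite_children: "w \<in> Field E \<Longrightarrow> finite (children w)"
  using nbrs_eq[of w] finite_nbrs[of w] by auto

lemma card_children:
  assumes "w \<in> Field E"
  shows "card (children w) = degree E w - (if w = p then 0 else 1)"
proof (cases "w = p")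
  case True
  then show ?thesis using nbrs_eq[OF assms] by (simp add: degree_def)
next
  case False
  have "parent w \<notin> children w"
    using parent(2)[of w] parent(2)[of "parent w"] assms False by (auto simp: children_def)
  then show ?thesis
    using nbrs_eq[OF assms] False finite_children[OF assms] by (simp add: degree_def)
qed

text \<open>
  Sums over edges of the value at the upper end are sums over vertices weighted by the number of
  children.
\<close>

lemma infsum_parent:
  fixes F :: "'v \<Rightarrow> real"
  assumes "(\<lambda>v. F (parent v)) summable_on (Field E - {p})"
  shows "(\<Sum>\<^sub>\<infinity>v\<in>Field E - {p}. F (parent v)) = (\<Sum>\<^sub>\<infinity>w\<in>Field E. real (card (children w)) * F w)"
proof -
  have bij: "bij_betw (\<lambda>v. (parent v, v)) (Field E - {p}) (Sigma (Field E) children)"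
    by (auto simp: bij_betw_def inj_on_def children_def image_def intro: parent_Field)
  have summ: "(\<lambda>(w, v). F w) summable_on Sigma (Field E) children"
    using assms summable_on_reindex_bij_betw[OF bij, of "\<lambda>(w, v). F w"] by simp
  have "(\<Sum>\<^sub>\<infinity>v\<in>Field E - {p}. F (parent v)) = infsum (\<lambda>(w, v). F w) (Sigma (Field E) children)"
    using infsum_reindex_bij_betw[OF bij, of "\<lambda>(w, v). F w"] by simp
  also have "\<dots> = (\<Sum>\<^sub>\<infinity>w\<in>Field E. \<Sum>\<^sub>\<infinity>v\<in>children w. F w)"
    using infsum_Sigma'_banach[OF summ] by simp
  also have "\<dots> = (\<Sum>\<^sub>\<infinity>w\<in>Field E. real (card (children w)) * F w)"
    by (intro infsum_cong) (simp add: finite_children)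
  finally show ?thesis .
qed

definition level :: "nat \<Rightarrow> 'v set" where
  "level n = {v \<in> Field E. depth v = n}"

lemma level_Suc: "level (Suc n) = (\<Union>w\<in>level n. children w)"
proof (intro set_eqI iffI)
  fix v assume v: "v \<in> level (Suc n)"
  then have v': "v \<in> Field E - {p}" by (auto simp: level_def)
  then show "v \<in> (\<Union>w\<in>level n. children w)"
    using parent(2)[OF v'] parent_Field[OF v'] v by (auto simp: children_def level_def)
next
  fix v assume "v \<in> (\<Union>w\<in>level n. children w)"
  then show "v \<in> level (Suc n)" using parent(2)[of v] by (auto simp: children_def level_def)
qed

lemma finite_level: "finite (level n)"
proof (induction n)
  case 0
  have "level 0 = {p}" using depth_eq_0 root by (auto simp: level_def)
  then show ?case by simp
next
  case (Suc n)
  then show ?case unfolding level_Suc by (auto simp: level_def intro: finite_children)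
qed

end

section \<open>From edges to vertex values\<close>

lemma edge_point_ends:
  assumes "v \<noteq> w"
  shows "edge_point (v, w) 0 = (\<lambda>x. if x = v then 1 else 0)"
    and "edge_point (v, w) 1 = (\<lambda>x. if x = w then 1 else 0)"
  using assms by (auto simp: edge_point_def)

definition vertex_value :: "(('v \<Rightarrow> real) \<Rightarrow> real) \<Rightarrow> 'v \<Rightarrow> real" where
  "vertex_value u v = u (\<lambda>x. if x = v then 1 else 0)"

lemma on_edge_ends:
  assumes "v \<noteq> w"
  shows "on_edge u (v, w) 0 = vertex_value u v" "on_edge u (v, w) 1 = vertex_value u w"
  using edge_point_ends[OF assms] by (simp_all add: on_edge_def vertex_value_def)

lemma continuous_edge_point: "continuous_on A (edge_point e)"
proof (rule continuous_on_coordinatewise_then_product)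
  fix x
  show "continuous_on A (\<lambda>t. edge_point e t x)"
    by (cases "x = fst e"; cases "x = snd e") (auto simp: edge_point_def intro!: continuous_intros)
qed

lemma continuous_on_edge:
  assumes "continuous_on (points E) u" "e \<in> E"
  shows "continuous_on {0..1} (on_edge u e)"
  unfolding on_edge_def
  by (rule continuous_on_compose2[OF assms(1) continuous_edge_point]) (use assms(2) in \<open>auto simp: points_def\<close>)

lemma H1_on_edge:
  assumes "u \<in> H1 E" "e \<in> E"
  shows "continuous_on {0..1} (on_edge u e)" "L2_interval (on_edge u e)"
    "L2_interval (weak_deriv (on_edge u e))" "has_weak_deriv (on_edge u e) (weak_deriv (on_edge u e))"
  using assms weak_deriv_of_H1[of "on_edge u e"] continuous_on_edge[of E u e] by (auto simp: H1_def H1_interval_def)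

lemma H1_summable:
  assumes u: "u \<in> H1 E"
  shows "(\<lambda>e. LINT t|unit_interval. (weak_deriv (on_edge u e) t)\<^sup>2) summable_on E"
    and "(\<lambda>e. LINT t|unit_interval. (on_edge u e t)\<^sup>2) summable_on E"
proof -
  let ?S = "\<lambda>e. LINT t|unit_interval. (weak_deriv (on_edge u e) t)\<^sup>2 + (on_edge u e t)\<^sup>2"
  have S: "?S summable_on E" using u by (simp add: H1_def)
  have split: "?S e = (LINT t|unit_interval. (weak_deriv (on_edge u e) t)\<^sup>2) + (LINT t|unit_interval. (on_edge u e t)\<^sup>2)"
    if "e \<in> E" for e
    using H1_on_edge[OF u that] by (intro Bochner_Integration.integral_add L2_interval_integrable_square)
  show "(\<lambda>e. LINT t|unit_interval. (weak_deriv (on_edge u e) t)\<^sup>2) summable_on E"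
    by (rule summable_on_comparison_test[OF S]) (auto simp: split)
  show "(\<lambda>e. LINT t|unit_interval. (on_edge u e t)\<^sup>2) summable_on E"
    by (rule summable_on_comparison_test[OF S]) (auto simp: split)
qed

lemma summable_on_diff: "f summable_on A \<Longrightarrow> g summable_on A \<Longrightarrow> (\<lambda>x. f x - g x :: real) summable_on A"
  using summable_on_add[of f A "\<lambda>x. - g x"] by (simp add: summable_on_uminus)

lemma infsum_diff:
  "f summable_on A \<Longrightarrow> g summable_on A \<Longrightarrow> (\<Sum>\<^sub>\<infinity>x\<in>A. f x - g x :: real) = infsum f A - infsum g A"
  using infsum_add[of f A "\<lambda>x. - g x"] by (simp add: summable_on_uminus infsum_uminus)

lemma mass_nonneg: "mass E u \<ge> 0"
  unfolding mass_def by (intro infsum_nonneg Bochner_Integration.integral_nonneg) auto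

lemma energy_nonneg: "energy E u \<ge> 0"
  unfolding energy_def by (intro infsum_nonneg Bochner_Integration.integral_nonneg) auto

text \<open>
  The angle with \<open>cos \<theta> = 2\<surd>2/3\<close>, that is \<open>3 cos \<theta> = 2\<surd>2\<close>, which balances the account of a vertex of degree 3.
\<close>

definition critical_angle :: real where
  "critical_angle = arcsin (1 / 3)"

lemma sin_critical_angle: "sin critical_angle = 1 / 3"
  by (simp add: critical_angle_def)

lemma cos_critical_angle: "cos critical_angle = 2 * sqrt 2 / 3"
proof -
  have "cos critical_angle = sqrt (1 - (1 / 3)\<^sup>2)"
    unfolding critical_angle_def by (rule cos_arcsin) auto
  also have "1 - (1 / 3 :: real)\<^sup>2 = 8 / 9" by (simp add: power2_eq_square)
  also have "sqrt (8 / 9) = 2 * sqrt 2 / 3"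
    by (rule real_sqrt_unique) (auto simp: power_divide power_mult_distrib)
  finally show ?thesis .
qed

lemma critical_angle_bounds:
  "0 < critical_angle" "critical_angle < pi / 2" "critical_angle\<^sup>2 \<le> 1 / 2"
proof -
  have "arcsin 0 < critical_angle"
    unfolding critical_angle_def by (rule arcsin_less_arcsin) auto
  then show pos: "0 < critical_angle" by simp
  have "critical_angle < arcsin (1 / 2)"
    unfolding critical_angle_def by (rule arcsin_less_arcsin) auto
  also have "\<dots> = pi / 6"
    by (subst sin_30[symmetric], rule arcsin_sin) (use pi_gt_zero in linarith)+
  finally have *: "critical_angle < pi / 6" .
  then show "critical_angle < pi / 2" using pi_gt_zero by linarith
  have "critical_angle \<le> 2 / 3" using * pi_less_4 by linarith
  then have "critical_angle\<^sup>2 \<le> (2 / 3)\<^sup>2" using pos by (intro power_mono) auto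
  also have "\<dots> \<le> 1 / 2" by (simp add: power2_eq_square)
  finally show "critical_angle\<^sup>2 \<le> 1 / 2" .
qed

text \<open>
  The difference of the two sides is a multiple of \<open>(a - \<surd>2 b)\<^sup>2\<close>.  Here \<open>a\<close> is the value at the parent and \<open>b\<close>
  at the child.  The right-hand side is built so that it cancels in the sum over all edges at a vertex with
  one parent and two children.
\<close>

lemma critical_quadratic_form:
  fixes a b :: real
  shows "2 * sqrt 2 / 3 * (a\<^sup>2 + b\<^sup>2) - 2 * a * b \<ge> sqrt 2 / 6 * (a\<^sup>2 - 2 * b\<^sup>2)"
proof -
  have "2 * sqrt 2 / 3 * (a\<^sup>2 + b\<^sup>2) - 2 * a * b - sqrt 2 / 6 * (a\<^sup>2 - 2 * b\<^sup>2)
      = sqrt 2 / 2 * (a - sqrt 2 * b)\<^sup>2"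
    by (simp add: power2_diff power_mult_distrib field_simps)
  then show ?thesis by (smt (verit) divide_nonneg_nonneg mult_nonneg_nonneg real_sqrt_ge_zero zero_le_power2)
qed

context rooted_tree
begin

lemma child_edge_ends:
  assumes v: "v \<in> Field E - {p}"
  shows "{on_edge u (child_edge v) 0, on_edge u (child_edge v) 1} = {vertex_value u v, vertex_value u (parent v)}"
    and "(on_edge u (child_edge v) 0)\<^sup>2 + (on_edge u (child_edge v) 1)\<^sup>2
      = (vertex_value u (parent v))\<^sup>2 + (vertex_value u v)\<^sup>2"
    and "on_edge u (child_edge v) 0 * on_edge u (child_edge v) 1 = vertex_value u (parent v) * vertex_value u v"
proof -
  have "v \<noteq> parent v" using parent(2)[OF v] by auto
  then show "{on_edge u (child_edge v) 0, on_edge u (child_edge v) 1} = {vertex_value u v, vertex_value u (parent v)}"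
    "(on_edge u (child_edge v) 0)\<^sup>2 + (on_edge u (child_edge v) 1)\<^sup>2
      = (vertex_value u (parent v))\<^sup>2 + (vertex_value u v)\<^sup>2"
    "on_edge u (child_edge v) 0 * on_edge u (child_edge v) 1 = vertex_value u (parent v) * vertex_value u v"
    using on_edge_ends[of v "parent v" u] on_edge_ends[of "parent v" v u]
    by (auto simp: child_edge_def insert_commute)
qed

lemma child_edge_in: "v \<in> Field E - {p} \<Longrightarrow> child_edge v \<in> E"
  using bij_betw_child_edge by (auto simp: bij_betw_def)

lemma summable_vertex_values:
  assumes u: "u \<in> H1 E"
  shows "(\<lambda>v. (vertex_value u v)\<^sup>2) summable_on (Field E - {p})"
    and "(\<lambda>v. (vertex_value u (parent v))\<^sup>2) summable_on (Field E - {p})"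
proof -
  let ?S = "\<lambda>e. LINT t|unit_interval. (weak_deriv (on_edge u e) t)\<^sup>2 + (on_edge u e t)\<^sup>2"
  have "?S summable_on E" using u by (simp add: H1_def)
  then have "(\<lambda>v. ?S (child_edge v)) summable_on (Field E - {p})"
    using summable_on_reindex_bij_betw[OF bij_betw_child_edge, of ?S] by simp
  then have S: "(\<lambda>v. 2 * ?S (child_edge v)) summable_on (Field E - {p})"
    by (rule summable_on_cmult_right)
  have le: "(vertex_value u v)\<^sup>2 \<le> 2 * ?S (child_edge v)" "(vertex_value u (parent v))\<^sup>2 \<le> 2 * ?S (child_edge v)"
    if v: "v \<in> Field E - {p}" for v
  proof -
    note H = H1_on_edge[OF u child_edge_in[OF v]]
    have "(on_edge u (child_edge v) 0)\<^sup>2 \<le> 2 * ?S (child_edge v)" "(on_edge u (child_edge v) 1)\<^sup>2 \<le> 2 * ?S (child_edge v)"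
      by (rule trace_square_le[OF H(1,3,4)]; simp)+
    then show "(vertex_value u v)\<^sup>2 \<le> 2 * ?S (child_edge v)" "(vertex_value u (parent v))\<^sup>2 \<le> 2 * ?S (child_edge v)"
      using child_edge_ends(1)[OF v, of u] by (auto simp: doubleton_eq_iff)
  qed
  show "(\<lambda>v. (vertex_value u v)\<^sup>2) summable_on (Field E - {p})"
    by (rule summable_on_comparison_test[OF S]) (use le in auto)
  show "(\<lambda>v. (vertex_value u (parent v))\<^sup>2) summable_on (Field E - {p})"
    by (rule summable_on_comparison_test[OF S]) (use le in auto)
qed

text \<open>
  Summing \<open>critical_quadratic_form\<close> over the edges charges \<open>- 2\<close> to a vertex for its parent and \<open>+ 1\<close> for
  each child.  The total is \<open>degree - 3\<close>, except at \<open>p\<close>, where no parent is charged and it is \<open>degree\<close>.  The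
  remainder of one edge \<open>e\<close> is kept.
\<close>

lemma critical_energy_lower_bound:
  assumes u: "u \<in> H1 E" and S: "finite S" "S \<subseteq> Field E" "\<And>w. w \<in> Field E - S \<Longrightarrow> degree E w = 3"
    and e: "e \<in> E" and t: "t \<in> {0..1}"
  shows "critical_angle * sqrt 2 / 2 * (3 * (vertex_value u p)\<^sup>2 + (\<Sum>w\<in>S. (real (degree E w) - 3) * (vertex_value u w)\<^sup>2))
      + (on_edge u e t - sine_profile critical_angle (on_edge u e 0) (on_edge u e 1) t)\<^sup>2 / 2
    \<le> energy E u - critical_angle\<^sup>2 * mass E u"
proof -
  let ?V = "Field E" and ?\<theta> = "critical_angle"
  define U where "U v = (vertex_value u v)\<^sup>2" for v
  define D where "D e = (LINT t|unit_interval. (weak_deriv (on_edge u e) t)\<^sup>2)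
    - ?\<theta>\<^sup>2 * (LINT t|unit_interval. (on_edge u e t)\<^sup>2)" for e
  define q where "q v = ?\<theta> * sqrt 2 / 2 * (U (parent v) - 2 * U v)" for v
  have summD: "D summable_on E" and D: "infsum D E = energy E u - ?\<theta>\<^sup>2 * mass E u"
    using H1_summable[OF u] unfolding D_def[abs_def] energy_def mass_def
    by (auto intro!: summable_on_diff summable_on_cmult_right simp: infsum_diff summable_on_cmult_right infsum_cmult_right)
  have bij: "bij_betw child_edge (?V - {p}) E" by (rule bij_betw_child_edge)
  have summDc: "(\<lambda>v. D (child_edge v)) summable_on (?V - {p})"
    using summD summable_on_reindex_bij_betw[OF bij, of D] by simp
  have Dc: "infsum (\<lambda>v. D (child_edge v)) (?V - {p}) = infsum D E"
    by (rule infsum_reindex_bij_betw[OF bij])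
  have summU: "U summable_on (?V - {p})" "(\<lambda>v. U (parent v)) summable_on (?V - {p})"
    using summable_vertex_values[OF u] by (simp_all add: U_def[abs_def])
  then have summq: "q summable_on (?V - {p})"
    unfolding q_def[abs_def] by (intro summable_on_cmult_right summable_on_diff)
  have summV: "U summable_on ?V"
    using summU(1) summable_on_insert_iff[of U p "?V - {p}"] root by (simp add: insert_absorb)
  have edge: "q v + (on_edge u (child_edge v) t
      - sine_profile ?\<theta> (on_edge u (child_edge v) 0) (on_edge u (child_edge v) 1) t)\<^sup>2 / 2 \<le> D (child_edge v)"
    if v: "v \<in> ?V - {p}" and t: "t \<in> {0..1}" for v t
  proof -
    note H = H1_on_edge[OF u child_edge_in[OF v]]
    have "q v \<le> ?\<theta> / sin ?\<theta> * (cos ?\<theta> * ((on_edge u (child_edge v) 0)\<^sup>2 + (on_edge u (child_edge v) 1)\<^sup>2)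
        - 2 * on_edge u (child_edge v) 0 * on_edge u (child_edge v) 1)"
    proof -
      have "q v = 3 * ?\<theta> * (sqrt 2 / 6 * (U (parent v) - 2 * U v))" by (simp add: q_def)
      also have "\<dots> \<le> 3 * ?\<theta> * (2 * sqrt 2 / 3 * (U (parent v) + U v) - 2 * vertex_value u (parent v) * vertex_value u v)"
        unfolding U_def using critical_angle_bounds(1) by (intro mult_left_mono critical_quadratic_form) auto
      finally show ?thesis
        unfolding mult.assoc child_edge_ends(2,3)[OF v] sin_critical_angle cos_critical_angle
        by (simp add: U_def algebra_simps)
    qed
    then show ?thesis
      using interval_energy_lower_bound[OF H(1,3,4) _ critical_angle_bounds(3) t]
      by (simp add: D_def sin_critical_angle)
  qed
  have "infsum q (?V - {p}) = ?\<theta> * sqrt 2 / 2 * (infsum (\<lambda>v. U (parent v)) (?V - {p}) - 2 * infsum U (?V - {p}))"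
    unfolding q_def[abs_def] infsum_cmult_right' using summU
    by (simp add: infsum_cmult_right infsum_diff summable_on_cmult_right)
  also have "infsum (\<lambda>v. U (parent v)) (?V - {p}) - 2 * infsum U (?V - {p})
      = 3 * U p + (\<Sum>w\<in>S. (real (degree E w) - 3) * U w)"
  proof -
    have card: "real (card (children w)) * U w = (real (degree E w) - 3) * U w + (2 * U w + (if w = p then U p else 0))"
      if w: "w \<in> ?V" for w
    proof -
      have "degree E w \<noteq> 0"
        using w finite_nbrs[of w] by (auto simp: degree_def Field_def adj_def)
      then have "real (card (children w)) = (real (degree E w) - 3) + 2 + (if w = p then 1 else 0)"
        using card_children[OF w] by (auto simp: of_nat_diff)
      then show ?thesis by (simp only: distrib_right) simp
    qed
    have supp: "((\<lambda>w. (real (degree E w) - 3) * U w) has_sum (\<Sum>w\<in>S. (real (degree E w) - 3) * U w)) ?V"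
      by (rule has_sum_finite_neutralI[where B=S]) (use S in auto)
    have supp': "((\<lambda>w. if w = p then U p else 0) has_sum (\<Sum>w\<in>{p}. if w = p then U p else 0)) ?V"
      by (rule has_sum_finite_neutralI[where B="{p}"]) (use root in auto)
    have "((\<lambda>w. (real (degree E w) - 3) * U w + (2 * U w + (if w = p then U p else 0))) has_sum
        (\<Sum>w\<in>S. (real (degree E w) - 3) * U w) + (2 * infsum U ?V + (\<Sum>w\<in>{p}. if w = p then U p else 0))) ?V"
      by (intro has_sum_add supp supp' has_sum_cmult_right has_sum_infsum summV)
    then have "infsum (\<lambda>v. U (parent v)) (?V - {p})
        = (\<Sum>w\<in>S. (real (degree E w) - 3) * U w) + (2 * infsum U ?V + U p)"
      unfolding infsum_parent[OF summU(2)] by (subst infsum_cong[OF card]) (auto dest: infsumI)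
    moreover have "infsum U ?V = U p + infsum U (?V - {p})"
      using infsum_insert[OF summU(1), of p] root by (simp add: insert_absorb)
    ultimately show ?thesis by simp
  qed
  finally have flux: "infsum q (?V - {p}) = ?\<theta> * sqrt 2 / 2 * (3 * U p + (\<Sum>w\<in>S. (real (degree E w) - 3) * U w))" .
  have "e \<in> child_edge ` (?V - {p})" using bij e by (simp add: bij_betw_def)
  then obtain v where v: "v \<in> ?V - {p}" "child_edge v = e" by blast
  have "(\<Sum>v\<in>{v}. D (child_edge v) - q v) \<le> (\<Sum>\<^sub>\<infinity>v\<in>?V - {p}. D (child_edge v) - q v)"
  proof (rule finite_sum_le_infsum)
    show "0 \<le> D (child_edge v) - q v" if "v \<in> ?V - {p} - {w}" for v w
      using edge[of v t] that t zero_le_power2 by (smt (verit) DiffD1 divide_nonneg_nonneg)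
  qed (use v summDc summq in \<open>auto intro: summable_on_diff\<close>)
  also have "\<dots> = infsum D E - infsum q (?V - {p})"
    using summDc summq by (simp add: infsum_diff Dc)
  finally show ?thesis
    using edge[OF v(1) t] flux v(2) by (simp add: D U_def)
qed

end

lemma Linf_norm_square_le:
  assumes u: "u \<in> H1 E" and E: "E \<noteq> {}" and B: "0 \<le> B"
    and le: "\<And>e t. e \<in> E \<Longrightarrow> t \<in> {0..1} \<Longrightarrow> (on_edge u e t)\<^sup>2 \<le> B"
  shows "(Linf_norm E u)\<^sup>2 \<le> ereal B"
proof -
  have meas: "(\<lambda>t. ereal \<bar>on_edge u e t\<bar>) \<in> borel_measurable unit_interval" if "e \<in> E" for e
    using L2_interval_borel[OF H1_on_edge(2)[OF u that]] by simp
  have "Linf_norm E u \<le> ereal (sqrt B)"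
    unfolding Linf_norm_def
  proof (intro SUP_least esssup_I meas)
    fix e assume e: "e \<in> E"
    have ptw: "\<bar>on_edge u e t\<bar> \<le> sqrt B" if "t \<in> {0..1}" for t
      using real_sqrt_le_mono[OF le[OF e that]] by simp
    show "AE t in unit_interval. ereal \<bar>on_edge u e t\<bar> \<le> ereal (sqrt B)"
      using AE_unit_interval_interior by eventually_elim (use ptw in auto)
  qed
  moreover have "0 \<le> Linf_norm E u"
  proof -
    obtain e where e: "e \<in> E" using E by auto
    have "(0 :: ereal) = esssup unit_interval (\<lambda>_. 0)"
      by (subst esssup_const) (auto simp: emeasure_restrict_space)
    also have "\<dots> \<le> esssup unit_interval (\<lambda>t. ereal \<bar>on_edge u e t\<bar>)"
      by (rule esssup_mono) auto
    also have "\<dots> \<le> Linf_norm E u" unfolding Linf_norm_def using e by (rule SUP_upper)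
    finally show ?thesis .
  qed
  ultimately obtain x where x: "Linf_norm E u = ereal x" "0 \<le> x" "x \<le> sqrt B"
    by (cases "Linf_norm E u") auto
  have "x\<^sup>2 \<le> (sqrt B)\<^sup>2" using x by (intro power_mono)
  then show ?thesis using x B by simp
qed

text \<open>
  A point of an edge is reached from its end points: the sine profile is bounded by the sum of the
  absolute end values, and the deviation from the profile by the remainder of that edge.
\<close>

lemma Linf_bound_of_vertex_bounds:
  fixes E :: "('v \<times> 'v) set"
  assumes E: "is_tree E" and c: "c > 0" and mu: "\<mu> \<le> critical_angle\<^sup>2"
    and vertex: "\<And>u v. u \<in> H1 E \<Longrightarrow> v \<in> Field E \<Longrightarrow>
      c * (vertex_value u v)\<^sup>2 \<le> energy E u - critical_angle\<^sup>2 * mass E u"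
    and rem: "\<And>u e t. u \<in> H1 E \<Longrightarrow> e \<in> E \<Longrightarrow> t \<in> {0..1} \<Longrightarrow>
      (on_edge u e t - sine_profile critical_angle (on_edge u e 0) (on_edge u e 1) t)\<^sup>2 / 2
        \<le> energy E u - critical_angle\<^sup>2 * mass E u"
  shows "\<exists>C>0. \<forall>u\<in>H1 E. ereal (energy E u - \<mu> * mass E u) \<ge> ereal C * (Linf_norm E u)\<^sup>2"
proof (intro exI conjI ballI)
  \<comment> \<open>The constant collects \<open>3 (1/c + 1/c + 2) = 6/c + 6\<close>: two end values, one remainder, and \<open>(x + y + z)\<^sup>2 \<le> 3 (x\<^sup>2 + y\<^sup>2 + z\<^sup>2)\<close>.\<close>
  show "0 < 1 / (6 / c + 6)" using c by (simp add: add_pos_pos)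
  fix u assume u: "u \<in> H1 E"
  define D where "D = energy E u - critical_angle\<^sup>2 * mass E u"
  have nonempty: "E \<noteq> {}" and asym: "asym E" using E by (auto simp: is_tree_def)
  have bound: "(on_edge u e t)\<^sup>2 \<le> (6 / c + 6) * D" if e: "e \<in> E" and t: "t \<in> {0..1}" for e t
  proof -
    obtain v w where vw: "e = (v, w)" by (cases e)
    have F: "v \<in> Field E" "w \<in> Field E" using e vw by (auto simp: Field_def)
    have neq: "v \<noteq> w" using e vw asymD[OF asym, of v w] by auto
    define a where "a = on_edge u e 0"
    define b where "b = on_edge u e 1"
    define s where "s = sine_profile critical_angle a b t"
    have ab: "a\<^sup>2 \<le> D / c" "b\<^sup>2 \<le> D / c"
      using vertex[OF u F(1)] vertex[OF u F(2)] c on_edge_ends[OF neq, of u]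
      by (auto simp: a_def b_def D_def vw le_divide_eq mult.commute)
    have w: "(on_edge u e t - s)\<^sup>2 \<le> 2 * D"
      using rem[OF u e t] by (simp add: D_def s_def a_def b_def)
    have "(on_edge u e t)\<^sup>2 \<le> 3 * (a\<^sup>2 + b\<^sup>2 + (on_edge u e t - s)\<^sup>2)"
    proof -
      have "\<bar>s\<bar> \<le> \<bar>a\<bar> + \<bar>b\<bar>"
        unfolding s_def by (rule sine_profile_abs_le[OF critical_angle_bounds(1,2) t])
      then have "\<bar>on_edge u e t\<bar> \<le> \<bar>a\<bar> + \<bar>b\<bar> + \<bar>on_edge u e t - s\<bar>" by linarith
      then have "\<bar>on_edge u e t\<bar>\<^sup>2 \<le> (\<bar>a\<bar> + \<bar>b\<bar> + \<bar>on_edge u e t - s\<bar>)\<^sup>2"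
        by (intro power_mono) auto
      moreover have "(x + y + z)\<^sup>2 \<le> 3 * (x\<^sup>2 + y\<^sup>2 + z\<^sup>2)" for x y z :: real
      proof -
        have "0 \<le> (x - y)\<^sup>2 + (y - z)\<^sup>2 + (x - z)\<^sup>2" by simp
        then show ?thesis by (simp add: power2_eq_square algebra_simps)
      qed
      from this[of "\<bar>a\<bar>" "\<bar>b\<bar>" "\<bar>on_edge u e t - s\<bar>"] calculation
      show ?thesis by simp
    qed
    also have "\<dots> \<le> 3 * (D / c + D / c + 2 * D)"
      by (intro mult_left_mono add_mono ab w) simp
    also have "\<dots> = (6 / c + 6) * D" by (simp add: field_simps)
    finally show ?thesis .
  qed
  obtain e where "e \<in> E" using nonempty by auto
  have "0 \<le> (6 / c + 6) * D" using order_trans[OF zero_le_power2 bound[OF \<open>e \<in> E\<close>, of 0]] by simp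
  then have "(Linf_norm E u)\<^sup>2 \<le> ereal ((6 / c + 6) * D)"
    by (rule Linf_norm_square_le[OF u nonempty]) (rule bound)
  then have "ereal (1 / (6 / c + 6)) * (Linf_norm E u)\<^sup>2 \<le> ereal (1 / (6 / c + 6)) * ereal ((6 / c + 6) * D)"
    using c by (intro ereal_mult_left_mono) auto
  also have "\<dots> = ereal D"
  proof -
    have "6 / c + 6 > 0" using c by (simp add: add_pos_pos)
    then show ?thesis by simp
  qed
  also have "\<dots> \<le> ereal (energy E u - \<mu> * mass E u)"
    using mult_right_mono[OF mu mass_nonneg[of E u]] by (simp add: D_def)
  finally show "ereal (1 / (6 / c + 6)) * (Linf_norm E u)\<^sup>2 \<le> ereal (energy E u - \<mu> * mass E u)" .
qed

lemma rooted_treeI: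
  assumes "is_tree E" "p \<in> Field E" "\<And>v. v \<in> Field E \<Longrightarrow> degree E v \<noteq> 0"
  shows "rooted_tree E p"
proof
  show "finite {w. (v, w) \<in> adj E}" for v
  proof (cases "v \<in> Field E")
    case True
    then show ?thesis using assms(3)[of v] card.infinite by (fastforce simp: degree_def)
  next
    case False
    then have "{w. (v, w) \<in> adj E} = {}" using adj_Field(1) by fast
    then show ?thesis by simp
  qed
qed (use assms in auto)

text \<open>
  All degrees are 3, so with \<open>p\<close> as root only the surplus at \<open>p\<close> survives.
\<close>

lemma unrooted_Linf_bound:
  assumes T: "unrooted_binary_tree T" and mu: "\<mu> \<le> critical_angle\<^sup>2"
  shows "\<exists>C>0. \<forall>u\<in>H1 T. ereal (energy T u - \<mu> * mass T u) \<ge> ereal C * (Linf_norm T u)\<^sup>2"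
proof (rule Linf_bound_of_vertex_bounds[OF _ _ mu])
  show tree: "is_tree T" using T by (simp add: unrooted_binary_tree_def)
  have deg: "degree T v = 3" if "v \<in> Field T" for v using T that by (simp add: unrooted_binary_tree_def)
  have main: "critical_angle * sqrt 2 / 2 * (3 * (vertex_value u p)\<^sup>2)
      + (on_edge u e t - sine_profile critical_angle (on_edge u e 0) (on_edge u e 1) t)\<^sup>2 / 2
    \<le> energy T u - critical_angle\<^sup>2 * mass T u"
    if "u \<in> H1 T" "p \<in> Field T" "e \<in> T" "t \<in> {0..1}" for u p e t
  proof -
    interpret rooted_tree T p by (rule rooted_treeI[OF tree that(2)]) (simp add: deg)
    show ?thesis using critical_energy_lower_bound[OF that(1), of "{}" e t] deg that by simp
  qed
  show "0 < critical_angle * sqrt 2 / 2 * 3" using critical_angle_bounds(1) by simp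
  obtain e where e: "e \<in> T" using tree by (auto simp: is_tree_def)
  show "critical_angle * sqrt 2 / 2 * 3 * (vertex_value u v)\<^sup>2 \<le> energy T u - critical_angle\<^sup>2 * mass T u"
    if "u \<in> H1 T" "v \<in> Field T" for u v
    using order_trans[OF _ main[OF that e, of 0], of "critical_angle * sqrt 2 / 2 * 3 * (vertex_value u v)\<^sup>2"]
    by (simp add: mult.assoc)
  show "(on_edge u e t - sine_profile critical_angle (on_edge u e 0) (on_edge u e 1) t)\<^sup>2 / 2
      \<le> energy T u - critical_angle\<^sup>2 * mass T u" if "u \<in> H1 T" "e \<in> T" "t \<in> {0..1}" for u e t
  proof -
    have F: "fst e \<in> Field T" using that(2) by (cases e) (auto simp: Field_def)
    have "0 \<le> critical_angle * sqrt 2 / 2 * (3 * (vertex_value u (fst e))\<^sup>2)"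
      using critical_angle_bounds(1) by simp
    then show ?thesis using main[OF that(1) F that(2,3)] by linarith
  qed
qed

text \<open>
  With a vertex \<open>p\<close> as root, the value at the vertex \<open>r\<close> of degree 1 enters with coefficient \<open>- 2\<close>; for
  \<open>p = r\<close> the net coefficient is \<open>3 - 2 = 1\<close>.  Twice the second estimate added to the first removes \<open>r\<close>.
\<close>

lemma rooted_Linf_bound:
  assumes T: "rooted_binary_tree T r" and mu: "\<mu> \<le> critical_angle\<^sup>2"
  shows "\<exists>C>0. \<forall>u\<in>H1 T. ereal (energy T u - \<mu> * mass T u) \<ge> ereal C * (Linf_norm T u)\<^sup>2"
proof (rule Linf_bound_of_vertex_bounds[OF _ _ mu])
  show tree: "is_tree T" using T by (simp add: rooted_binary_tree_def)
  define k where "k = critical_angle * sqrt 2 / 2"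
  have deg: "r \<in> Field T" "degree T r = 1" "\<And>v. v \<in> Field T - {r} \<Longrightarrow> degree T v = 3"
    using T by (auto simp: rooted_binary_tree_def)
  have main: "k * (3 * (vertex_value u p)\<^sup>2 - 2 * (vertex_value u r)\<^sup>2)
      + (on_edge u e t - sine_profile critical_angle (on_edge u e 0) (on_edge u e 1) t)\<^sup>2 / 2
    \<le> energy T u - critical_angle\<^sup>2 * mass T u"
    if "u \<in> H1 T" "p \<in> Field T" "e \<in> T" "t \<in> {0..1}" for u p e t
  proof -
    interpret rooted_tree T p
      by (rule rooted_treeI[OF tree that(2)]) (metis DiffI deg(2,3) numeral_neq_zero one_neq_zero singletonD)
    show ?thesis using critical_energy_lower_bound[OF that(1), of "{r}" e t] deg that by (simp add: k_def)
  qed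
  show k: "0 < k" using critical_angle_bounds(1) by (simp add: k_def)
  have at_root: "k * (vertex_value u r)\<^sup>2
      + (on_edge u e t - sine_profile critical_angle (on_edge u e 0) (on_edge u e 1) t)\<^sup>2 / 2
    \<le> energy T u - critical_angle\<^sup>2 * mass T u"
    if "u \<in> H1 T" "e \<in> T" "t \<in> {0..1}" for u e t
    using main[OF that(1) deg(1) that(2,3)] by simp
  obtain e where e: "e \<in> T" using tree by (auto simp: is_tree_def)
  show "k * (vertex_value u v)\<^sup>2 \<le> energy T u - critical_angle\<^sup>2 * mass T u"
    if u: "u \<in> H1 T" and v: "v \<in> Field T" for u v
  proof -
    have "k * (3 * (vertex_value u v)\<^sup>2 - 2 * (vertex_value u r)\<^sup>2) \<le> energy T u - critical_angle\<^sup>2 * mass T u"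
      by (rule order_trans[OF _ main[OF u v e, of 0]]) auto
    moreover have "k * (vertex_value u r)\<^sup>2 \<le> energy T u - critical_angle\<^sup>2 * mass T u"
      by (rule order_trans[OF _ at_root[OF u e, of 0]]) auto
    ultimately show ?thesis by (simp add: right_diff_distrib)
  qed
  show "(on_edge u e t - sine_profile critical_angle (on_edge u e 0) (on_edge u e 1) t)\<^sup>2 / 2
      \<le> energy T u - critical_angle\<^sup>2 * mass T u" if "u \<in> H1 T" "e \<in> T" "t \<in> {0..1}" for u e t
  proof -
    have "0 \<le> k * (vertex_value u r)\<^sup>2" using k by simp
    then show ?thesis using at_root[OF that] by linarith
  qed
qed

section \<open>Trial functions for the unrooted binary tree\<close>

locale rooted_regular_tree = rooted_tree E p for E :: "('v \<times> 'v) set" and p +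
  assumes degree: "\<And>v. v \<in> Field E \<Longrightarrow> degree E v = 3"
begin

lemma card_level: "card (level (Suc n)) = 3 * 2 ^ n"
proof -
  have *: "card (level (Suc n)) = (\<Sum>w\<in>level n. card (children w))" for n
    unfolding level_Suc
  proof (rule card_UN_disjoint[OF finite_level])
    show "\<forall>i\<in>level n. finite (children i)" by (auto simp: level_def intro: finite_children)
    show "\<forall>i\<in>level n. \<forall>j\<in>level n. i \<noteq> j \<longrightarrow> children i \<inter> children j = {}"
      by (auto simp: children_def)
  qed
  show ?thesis
  proof (induction n)
    case 0
    have "level 0 = {p}" using depth_eq_0 root by (auto simp: level_def)
    then show ?case using card_children[OF root] degree[OF root] by (simp add: *)
  next
    case (Suc n)
    have "card (children w) = 2" if "w \<in> level (Suc n)" for w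
    proof -
      have "w \<in> Field E" "w \<noteq> p" using that by (auto simp: level_def)
      then show ?thesis using card_children degree by simp
    qed
    then have "card (level (Suc (Suc n))) = card (level (Suc n)) * 2" by (simp add: *[of "Suc n"])
    then show ?case using Suc by simp
  qed
qed

definition trial_coeff :: "nat \<Rightarrow> 'v \<Rightarrow> real" where
  "trial_coeff N v = (if v \<in> Field E \<and> depth v \<le> N then (1 / sqrt 2) ^ depth v else 0)"

text \<open>
  In barycentric coordinates a sine profile with end values \<open>a\<close>, \<open>b\<close> is \<open>a sin(\<theta> x\<^sub>v) + b sin(\<theta> x\<^sub>w)\<close> up to the
  factor \<open>1/sin \<theta>\<close>.  Since \<open>sin 0 = 0\<close>, a single finite sum over vertices gives all profiles at once, and its
  continuity on the whole tree is evident.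
\<close>

definition trial :: "nat \<Rightarrow> ('v \<Rightarrow> real) \<Rightarrow> real" where
  "trial N x = (\<Sum>v\<in>{v \<in> Field E. depth v \<le> N}. trial_coeff N v * sin (critical_angle * x v) / sin critical_angle)"

lemma finite_ball: "finite {v \<in> Field E. depth v \<le> N}"
proof -
  have "{v \<in> Field E. depth v \<le> N} = (\<Union>n\<le>N. level n)" by (auto simp: level_def)
  then show ?thesis by (simp add: finite_level)
qed

lemma on_edge_trial:
  assumes "e \<in> E"
  shows "on_edge (trial N) e = sine_profile critical_angle (trial_coeff N (fst e)) (trial_coeff N (snd e))"
proof
  fix t
  obtain v w where e: "e = (v, w)" by (cases e)
  have F: "v \<in> Field E" "w \<in> Field E" using assms e by (auto simp: Field_def)
  have neq: "v \<noteq> w" using assms e asym_edges[of v w] by auto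
  let ?g = "\<lambda>x. trial_coeff N x * sin (critical_angle * edge_point e t x) / sin critical_angle"
  have "on_edge (trial N) e t = sum ?g {v \<in> Field E. depth v \<le> N}"
    by (simp add: on_edge_def trial_def)
  also have "\<dots> = sum ?g ({v \<in> Field E. depth v \<le> N} \<union> {v, w})"
    by (rule sum.mono_neutral_left) (use finite_ball in \<open>auto simp: trial_coeff_def\<close>)
  also have "\<dots> = sum ?g {v, w}"
    by (rule sum.mono_neutral_right) (use finite_ball in \<open>auto simp: edge_point_def e\<close>)
  also have "\<dots> = sine_profile critical_angle (trial_coeff N v) (trial_coeff N w) t"
    using neq by (simp add: e edge_point_def sine_profile_def add_divide_distrib)
  finally show "on_edge (trial N) e t = sine_profile critical_angle (trial_coeff N (fst e)) (trial_coeff N (snd e)) t"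
    by (simp add: e)
qed

lemma trial_edge_finite: "finite {e \<in> E. trial_coeff N (fst e) \<noteq> 0 \<or> trial_coeff N (snd e) \<noteq> 0}"
proof (rule finite_subset)
  show "{e \<in> E. trial_coeff N (fst e) \<noteq> 0 \<or> trial_coeff N (snd e) \<noteq> 0}
      \<subseteq> child_edge ` {v \<in> Field E. depth v \<le> Suc N}"
  proof
    fix e assume e: "e \<in> {e \<in> E. trial_coeff N (fst e) \<noteq> 0 \<or> trial_coeff N (snd e) \<noteq> 0}"
    have "e \<in> child_edge ` (Field E - {p})" using e bij_betw_child_edge by (simp add: bij_betw_def)
    then obtain v where v: "v \<in> Field E - {p}" "e = child_edge v" by blast
    have "depth v \<le> N \<or> depth (parent v) \<le> N"
      using e v by (auto simp: child_edge_def trial_coeff_def split: if_splits)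
    then have "depth v \<le> Suc N" using parent(2)[OF v(1)] by auto
    then show "e \<in> child_edge ` {v \<in> Field E. depth v \<le> Suc N}" using v by auto
  qed
  show "finite (child_edge ` {v \<in> Field E. depth v \<le> Suc N})" using finite_ball by blast
qed

lemma trial_in_H1: "trial N \<in> H1 E"
  unfolding H1_def
proof (intro CollectI conjI ballI)
  have "continuous_on UNIV (\<lambda>x::'v \<Rightarrow> real. x v)" for v
    by (rule continuous_on_product_coordinates)
  then have coord: "continuous_on (points E) (\<lambda>x. x v)" for v
    by (rule continuous_on_subset) simp
  have "continuous_on (points E) (\<lambda>x. sin (critical_angle * x v))" for v
    by (rule continuous_on_compose2[of UNIV sin, OF _ continuous_on_mult_left[OF coord]])
      (auto intro: continuous_intros)
  then show "continuous_on (points E) (trial N)"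
    unfolding trial_def divide_inverse
    by (intro continuous_on_sum continuous_on_mult_left continuous_on_mult_right)
  show "H1_interval (on_edge (trial N) e)" if "e \<in> E" for e
    unfolding on_edge_trial[OF that] by (rule H1_interval_sine_profile)
  let ?S = "\<lambda>e. LINT t|unit_interval. (weak_deriv (on_edge (trial N) e) t)\<^sup>2 + (on_edge (trial N) e t)\<^sup>2"
  have z: "?S e = 0" if "e \<in> E" "trial_coeff N (fst e) = 0" "trial_coeff N (snd e) = 0" for e
  proof -
    have oe: "on_edge (trial N) e = sine_profile critical_angle 0 0"
      using on_edge_trial[OF that(1)] that by simp
    have "(LINT t|unit_interval. (weak_deriv (sine_profile critical_angle 0 0) t)\<^sup>2) = 0"
      unfolding energy_sine_profile by (simp add: sine_profile_deriv_def)
    then show ?thesis unfolding oe by (simp add: sine_profile_zero)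
  qed
  have "?S summable_on {e \<in> E. trial_coeff N (fst e) \<noteq> 0 \<or> trial_coeff N (snd e) \<noteq> 0}"
    by (intro summable_on_finite trial_edge_finite)
  also have "?this \<longleftrightarrow> ?S summable_on E"
    by (rule summable_on_cong_neutral) (use z in auto)
  finally show "?S summable_on E" .
qed

text \<open>
  Between depths \<open>k < N\<close> and \<open>k + 1\<close> the end values have ratio \<open>\<surd>2\<close> and the edge contributes zero.  Each of the
  \<open>3 \<cdot> 2\<^sup>N\<close> edges that leave depth \<open>N\<close> contributes \<open>2\<surd>2 \<theta> / 2\<^sup>N\<close>.
\<close>

lemma trial_defect:
  "energy E (trial N) - critical_angle\<^sup>2 * mass E (trial N) = 6 * sqrt 2 * critical_angle"
proof -
  let ?c = "trial_coeff N"
  define D where "D e = (LINT t|unit_interval. (weak_deriv (on_edge (trial N) e) t)\<^sup>2)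
    - critical_angle\<^sup>2 * (LINT t|unit_interval. (on_edge (trial N) e t)\<^sup>2)" for e
  have De: "D e = 3 * critical_angle * (2 * sqrt 2 / 3 * ((?c (fst e))\<^sup>2 + (?c (snd e))\<^sup>2) - 2 * ?c (fst e) * ?c (snd e))"
    if "e \<in> E" for e
    unfolding D_def on_edge_trial[OF that] energy_sine_profile
    by (subst defect_sine_profile) (simp_all add: sin_critical_angle cos_critical_angle)
  have Dv: "D (child_edge v) = 3 * critical_angle * (2 * sqrt 2 / 3 * ((?c v)\<^sup>2 + (?c (parent v))\<^sup>2) - 2 * ?c v * ?c (parent v))"
    if v: "v \<in> Field E - {p}" for v
    using De[OF child_edge_in[OF v]] by (auto simp: child_edge_def algebra_simps)
  have edge: "D (child_edge v) = (if v \<in> level (Suc N) then 2 * sqrt 2 * critical_angle / 2 ^ N else 0)"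
    if v: "v \<in> Field E - {p}" for v
  proof -
    define k where "k = depth (parent v)"
    have k: "depth v = Suc k" using parent(2)[OF v] by (simp add: k_def)
    have F: "v \<in> Field E" "parent v \<in> Field E" using v parent_Field[OF v] by auto
    consider "k < N" | "k = N" | "k > N" by linarith
    then show ?thesis
    proof cases
      case 1
      then have c: "?c (parent v) = (1 / sqrt 2) ^ k" "?c v = (1 / sqrt 2) ^ k / sqrt 2"
        using F k by (auto simp: trial_coeff_def k_def)
      have "2 * sqrt 2 / 3 * ((?c v)\<^sup>2 + (?c (parent v))\<^sup>2) - 2 * ?c v * ?c (parent v)
        = ((1 / sqrt 2) ^ k)\<^sup>2 * (sqrt 2 - 2 / sqrt 2)"
        unfolding c by (simp add: power_divide power2_eq_square field_simps)
      also have "sqrt 2 - 2 / sqrt 2 = 0" by (simp add: real_div_sqrt)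
      finally show ?thesis using Dv[OF v] 1 k by (simp add: level_def)
    next
      case 2
      then have c: "?c (parent v) = (1 / sqrt 2) ^ N" "?c v = 0" "v \<in> level (Suc N)"
        using F k by (auto simp: trial_coeff_def level_def k_def)
      have "((1 / sqrt 2) ^ N)\<^sup>2 = (1 / 2 ^ N :: real)"
        by (simp add: power_divide power2_eq_square flip: power_mult_distrib)
      then show ?thesis using Dv[OF v] c by simp
    next
      case 3
      then have "?c (parent v) = 0" "?c v = 0" using k by (auto simp: trial_coeff_def k_def)
      then show ?thesis using Dv[OF v] 3 k by (simp add: level_def)
    qed
  qed
  have "energy E (trial N) - critical_angle\<^sup>2 * mass E (trial N) = infsum D E"
    using H1_summable[OF trial_in_H1] unfolding D_def[abs_def] energy_def mass_def
    by (simp add: infsum_diff summable_on_cmult_right infsum_cmult_right)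
  also have "\<dots> = infsum (\<lambda>v. D (child_edge v)) (Field E - {p})"
    using infsum_reindex_bij_betw[OF bij_betw_child_edge, of D] by simp
  also have "\<dots> = infsum (\<lambda>v. 2 * sqrt 2 * critical_angle / 2 ^ N) (level (Suc N))"
    by (rule infsum_cong_neutral) (auto simp: edge level_def)
  also have "\<dots> = 6 * sqrt 2 * critical_angle"
    by (simp add: finite_level card_level)
  finally show ?thesis .
qed

text \<open>
  On the edge above a vertex of depth \<open>k \<le> N\<close> the trial function is at least \<open>2\<^sup>-\<^sup>k\<^sup>/\<^sup>2\<close>, and there are
  \<open>3 \<cdot> 2\<^sup>k\<^sup>-\<^sup>1\<close> such edges, so every level adds \<open>3/2\<close> to the mass.
\<close>

lemma trial_mass_ge: "mass E (trial N) \<ge> 3 / 2 * real N"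
proof -
  let ?c = "trial_coeff N"
  define m where "m e = (LINT t|unit_interval. (on_edge (trial N) e t)\<^sup>2)" for e
  define B where "B = (\<Union>k<N. level (Suc k))"
  have finB: "finite B" unfolding B_def by (simp add: finite_level)
  have BV: "B \<subseteq> Field E - {p}" by (auto simp: B_def level_def)
  have m: "(1 / 2) ^ depth v \<le> m (child_edge v)" if v: "v \<in> B" for v
  proof -
    have v': "v \<in> Field E - {p}" "depth v \<le> N" using v BV by (auto simp: B_def level_def)
    have e: "child_edge v \<in> E" by (rule child_edge_in[OF v'(1)])
    have pv: "depth v = Suc (depth (parent v))" "parent v \<in> Field E"
      using parent(2)[OF v'(1)] parent_Field[OF v'(1)] by auto
    have "?c v = (1 / sqrt 2) ^ depth v" using v' by (simp add: trial_coeff_def)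
    moreover have "?c (parent v) = (1 / sqrt 2) ^ depth (parent v)" using v' pv by (simp add: trial_coeff_def)
    moreover have "(1 / sqrt 2) ^ depth v \<le> (1 / sqrt 2) ^ depth (parent v)"
      using pv by (intro power_decreasing) auto
    ultimately have c: "(1 / sqrt 2) ^ depth v \<le> ?c (fst (child_edge v))" "(1 / sqrt 2) ^ depth v \<le> ?c (snd (child_edge v))"
      by (auto simp: child_edge_def)
    have L: "L2_interval (on_edge (trial N) (child_edge v))" by (rule H1_on_edge(2)[OF trial_in_H1 e])
    have "(1 / 2 :: real) ^ depth v = ((1 / sqrt 2) ^ depth v)\<^sup>2"
      by (simp add: power_divide power2_eq_square flip: power_mult_distrib)
    also have "\<dots> = (LINT t|unit_interval. ((1 / sqrt 2) ^ depth v)\<^sup>2)"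
      by (simp add: measure_restrict_space)
    also have "\<dots> \<le> m (child_edge v)"
      unfolding m_def
    proof (rule integral_mono)
      show "integrable unit_interval (\<lambda>t. ((1 / sqrt 2) ^ depth v)\<^sup>2)"
        by (intro L2_interval_integrable L2_interval_continuous) auto
      show "integrable unit_interval (\<lambda>t. (on_edge (trial N) (child_edge v) t)\<^sup>2)"
        by (rule L2_interval_integrable_square[OF L])
      fix t assume "t \<in> space unit_interval"
      then have t: "t \<in> {0..1}" by simp
      have "(1 / sqrt 2) ^ depth v \<le> on_edge (trial N) (child_edge v) t"
        unfolding on_edge_trial[OF e]
        by (rule sine_profile_ge[OF critical_angle_bounds(1,2) t _ c]) simp
      then show "((1 / sqrt 2) ^ depth v)\<^sup>2 \<le> (on_edge (trial N) (child_edge v) t)\<^sup>2"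
        by (intro power_mono) auto
    qed
    finally show ?thesis .
  qed
  have "(\<Sum>v\<in>B. (1 / 2 :: real) ^ depth v) = (\<Sum>k<N. \<Sum>v\<in>level (Suc k). (1 / 2) ^ depth v)"
    unfolding B_def by (rule sum.UNION_disjoint) (auto simp: finite_level, auto simp: level_def)
  also have "\<dots> = (\<Sum>k<N. 3 / 2)"
  proof (rule sum.cong)
    fix k
    have "(\<Sum>v\<in>level (Suc k). (1 / 2 :: real) ^ depth v) = (\<Sum>v\<in>level (Suc k). (1 / 2) ^ Suc k)"
      by (rule sum.cong) (auto simp: level_def)
    also have "\<dots> = 3 / 2" by (simp add: card_level power_divide)
    finally show "(\<Sum>v\<in>level (Suc k). (1 / 2 :: real) ^ depth v) = 3 / 2" .
  qed simp
  also have "\<dots> = 3 / 2 * real N" by simp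
  finally have "3 / 2 * real N \<le> (\<Sum>v\<in>B. m (child_edge v))"
    using sum_mono[of B "\<lambda>v. (1 / 2) ^ depth v" "\<lambda>v. m (child_edge v)"] m by simp
  also have "\<dots> \<le> (\<Sum>\<^sub>\<infinity>v\<in>Field E - {p}. m (child_edge v))"
  proof (rule finite_sum_le_infsum[OF _ finB BV])
    show "(\<lambda>v. m (child_edge v)) summable_on Field E - {p}"
      using H1_summable(2)[OF trial_in_H1] summable_on_reindex_bij_betw[OF bij_betw_child_edge, of m]
      by (simp add: m_def[abs_def])
  qed (simp add: m_def)
  also have "\<dots> = mass E (trial N)"
    using infsum_reindex_bij_betw[OF bij_betw_child_edge, of m] by (simp add: mass_def m_def[abs_def])
  finally show ?thesis .
qed

lemma trial_nonzero: "\<exists>x\<in>points E. trial N x \<noteq> 0"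
proof -
  obtain e where e: "e \<in> E" "p = fst e \<or> p = snd e"
    using root by (force simp: Field_def)
  define t :: real where "t = (if p = fst e then 0 else 1)"
  have "on_edge (trial N) e t = trial_coeff N p"
    using e(2) sine_profile_ends[of critical_angle "trial_coeff N (fst e)" "trial_coeff N (snd e)"]
    by (auto simp: on_edge_trial[OF e(1)] t_def sin_critical_angle)
  also have "\<dots> = 1" using root by (simp add: trial_coeff_def)
  finally have "trial N (edge_point e t) \<noteq> 0" by (simp add: on_edge_def)
  moreover have "edge_point e t \<in> points E" using e(1) by (force simp: points_def t_def)
  ultimately show ?thesis by blast
qed

lemma lambda1_le: "lambda1 E \<le> critical_angle\<^sup>2"
proof (rule field_le_epsilon)
  fix \<epsilon> :: real assume \<epsilon>: "\<epsilon> > 0"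
  let ?C = "6 * sqrt 2 * critical_angle"
  have C: "0 < ?C" using critical_angle_bounds(1) by simp
  obtain N :: nat where N: "?C / \<epsilon> < real N" using reals_Archimedean2 by blast
  have M: "real N \<le> mass E (trial N)" using trial_mass_ge[of N] by simp
  have "0 < ?C / \<epsilon>" using C \<epsilon> by simp
  then have pos: "0 < mass E (trial N)" using N M by linarith
  have "?C < \<epsilon> * mass E (trial N)"
  proof -
    have "?C < \<epsilon> * real N" using N \<epsilon> by (simp add: divide_less_eq mult.commute)
    also have "\<dots> \<le> \<epsilon> * mass E (trial N)" using M \<epsilon> by (intro mult_left_mono) auto
    finally show ?thesis .
  qed
  then have "energy E (trial N) / mass E (trial N) \<le> critical_angle\<^sup>2 + \<epsilon>"
    using trial_defect[of N] pos by (simp add: divide_le_eq distrib_right)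
  moreover have "lambda1 E \<le> energy E (trial N) / mass E (trial N)"
    unfolding lambda1_def
  proof (rule cINF_lower)
    show "bdd_below ((\<lambda>u. energy E u / mass E u) ` {u \<in> H1 E. \<exists>x\<in>points E. u x \<noteq> 0})"
      by (rule bdd_belowI2[of _ 0]) (simp add: energy_nonneg mass_nonneg)
    show "trial N \<in> {u \<in> H1 E. \<exists>x\<in>points E. u x \<noteq> 0}"
      using trial_in_H1 trial_nonzero by blast
  qed
  ultimately show "lambda1 E \<le> critical_angle\<^sup>2 + \<epsilon>" by linarith
qed

end

lemma unrooted_lambda1_le:
  assumes T: "unrooted_binary_tree T"
  shows "lambda1 T \<le> critical_angle\<^sup>2"
proof -
  have tree: "is_tree T" and deg: "\<And>v. v \<in> Field T \<Longrightarrow> degree T v = 3"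
    using T by (auto simp: unrooted_binary_tree_def)
  obtain p where p: "p \<in> Field T" using tree by (fastforce simp: is_tree_def Field_def)
  interpret rooted_tree T p by (rule rooted_treeI[OF tree p]) (simp add: deg)
  interpret rooted_regular_tree T p by unfold_locales (rule deg)
  show ?thesis by (rule lambda1_le)
qed

theorem theorem1p5:
  fixes T :: "('a \<times> 'a) set" and To :: "('b \<times> 'b) set" and r :: 'b
  assumes "unrooted_binary_tree T" and "rooted_binary_tree To r"
  shows "(\<exists>C>0. \<forall>u\<in>H1 T.
            ereal (energy T u - lambda1 T * mass T u) \<ge> ereal C * (Linf_norm T u)\<^sup>2) \<and>
         (\<exists>C>0. \<forall>u\<in>H1 To.
            ereal (energy To u - lambda1 T * mass To u) \<ge> ereal C * (Linf_norm To u)\<^sup>2)"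
  using unrooted_Linf_bound[OF assms(1)] rooted_Linf_bound[OF assms(2)] unrooted_lambda1_le[OF assms(1)]
  by blast

end
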